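(* (Clock Theorem) Let $G$ be a plane balanced transverse graph with root $r$ the head of an edge adjacent to the unbounded region. Then any two spanning trees of $G$ (that is, oriented spanning trees rooted at $r$) can be related by a sequence of clock moves.
   Context: **Setting.** A plane balanced transverse graph $G$ is a finite connected directed graph (loops and multiple edges allowed) embedded in $\mathbb{R}^2$ such that at every vertex the in-degree equals the out-degree, and in the cyclic order of edge-ends around each vertex the incoming ends are consecutive and the outgoing ends are consecutive. Fix an edge $e_0$ adjacent to the unbounded region of $\mathbb{R}^2\setminus G$ and let $r=v_0$ be its head. The other vertices are $v_1,\dots,v_k$ (in arbitrary order); $v_i$ has $d_i$ incoming edges. Order the incoming edges at $v_i$ counter-clockwise around $v_i$ (starting with the "leftmost" one, i.e. the one preceded by an outgoing edge in counter-clockwise cyclic order), and let $e_{i,j}$ be the $j$-th one. **Lattice points.** A lattice point $\vec{x}=(x_1,\dots,x_k)$ with integers $1\le x_i\le d_i$ represents the spanning subgraph $H$ of $G$ with edge set $\bigcup_{i=1}^k\{e_{i,x_i}\}$. **Spanning trees.** An oriented spanning tree of $G$ rooted at $r$ is a spanning subgraph in which every vertex $v\ne r$ has in-degree $1$, $r$ has in-degree $0$, and there is no oriented cycle. "Spanning tree" always means oriented spanning tree rooted at $r$; each is represented by a unique lattice point. **Clock moves.** Lattice points $\vec{x},\vec{x'}$ are neighboring if there is a unique index $i$ with $x_i=x_i'\pm1$ and $x_j=x_j'$ for all $j\ne i$. Two spanning trees are related by a clock move if they are represented by neighboring lattice points. (All intermediate subgraphs in a sequence of clock moves are thus required to be spanning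 trees.) *)

theory Defs
  imports "Graph_Theory.Graph_Theory" "HOL-Analysis.Analysis"
begin

section \<open>Plane directed graphs\<close>

text \<open>
  The plane is \<^typ>\<open>complex\<close>, with its usual orientation. Vertices are points of the plane, and
  \<open>\<gamma> e\<close> parametrises the edge \<open>e\<close> from its tail to its head. \<^const>\<open>simple_path\<close> allows the two
  endpoints to coincide, so loops are Jordan curves and all other edges are arcs; multiple edges
  are distinct elements of \<^term>\<open>arcs G\<close> with the same tail and head.
\<close>

locale plane_digraph = fin_digraph G for G :: "(complex, 'e) pre_digraph" +
  fixes \<gamma> :: "'e \<Rightarrow> real \<Rightarrow> complex"
  assumes edge_simple_path: "e \<in> arcs G \<Longrightarrow> simple_path (\<gamma> e)"
    and edge_start: "e \<in> arcs G \<Longrightarrow> pathstart (\<gamma> e) = tail G e"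
    and edge_finish: "e \<in> arcs G \<Longrightarrow> pathfinish (\<gamma> e) = head G e"
    and edge_avoids_verts: "e \<in> arcs G \<Longrightarrow> \<gamma> e ` {0<..<1} \<inter> verts G = {}"
    and edges_disjoint: "\<lbrakk>e \<in> arcs G; f \<in> arcs G; e \<noteq> f\<rbrakk> \<Longrightarrow>
           \<gamma> e ` {0<..<1} \<inter> \<gamma> f ` {0<..<1} = {}"

definition drawing :: "(complex, 'e) pre_digraph \<Rightarrow> ('e \<Rightarrow> real \<Rightarrow> complex) \<Rightarrow> complex set" where
  "drawing G \<gamma> = verts G \<union> (\<Union>e\<in>arcs G. path_image (\<gamma> e))"

definition outer_edge ::
  "(complex, 'e) pre_digraph \<Rightarrow> ('e \<Rightarrow> real \<Rightarrow> complex) \<Rightarrow> 'e \<Rightarrow> bool" where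
  "outer_edge G \<gamma> e \<longleftrightarrow> e \<in> arcs G \<and>
     (\<exists>U \<in> components (- drawing G \<gamma>). \<not> bounded U \<and> path_image (\<gamma> e) \<subseteq> frontier U)"


section \<open>The cyclic order of edge-ends around a vertex\<close>

text \<open>
  Every edge \<open>e\<close> has two ends: \<open>Out e\<close> at its tail and \<open>In e\<close> at its head. A loop thus contributes
  two ends to its vertex. An end is drawn as the half of the edge that starts at the vertex.
\<close>

datatype 'e edge_end = Out 'e | In 'e

definition ends_at :: "(complex, 'e) pre_digraph \<Rightarrow> complex \<Rightarrow> 'e edge_end set" where
  "ends_at G v = Out ` out_arcs G v \<union> In ` in_arcs G v"

fun half_edge :: "('e \<Rightarrow> real \<Rightarrow> complex) \<Rightarrow> 'e edge_end \<Rightarrow> real \<Rightarrow> complex" where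
  "half_edge \<gamma> (Out e) = subpath 0 (1/2) (\<gamma> e)"
| "half_edge \<gamma> (In e) = subpath 1 (1/2) (\<gamma> e)"

text \<open>
  The point at which the half-edge leaves the closed disc of radius \<open>\<rho>\<close> around \<open>v\<close> for the last
  time.
\<close>

definition exit_point ::
  "('e \<Rightarrow> real \<Rightarrow> complex) \<Rightarrow> complex \<Rightarrow> real \<Rightarrow> 'e edge_end \<Rightarrow> complex" where
  "exit_point \<gamma> v \<rho> a = half_edge \<gamma> a (Sup {t \<in> {0..1}. dist v (half_edge \<gamma> a t) \<le> \<rho>})"

text \<open>The counter-clockwise angle at \<open>v\<close> from \<open>p\<close> to \<open>q\<close>, in \<open>[0, 2\<pi>)\<close>.\<close>

definition ccw_angle :: "complex \<Rightarrow> complex \<Rightarrow> complex \<Rightarrow> real" where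
  "ccw_angle v p q = Arg2pi ((q - v) / (p - v))"

text \<open>
  Distinct ends \<open>a\<close>, \<open>b\<close>, \<open>c\<close> at \<open>v\<close> are met in this cyclic order when turning counter-clockwise
  around \<open>v\<close>. Edges are arbitrary continuous curves and need not have a tangent direction at \<open>v\<close>,
  so the order is read off on small circles. For \<open>\<rho>\<close> small enough the half-edges cross the region
  outside the disc, after their exit points, as disjoint curves, so that the cyclic order of the
  exit points does not depend on \<open>\<rho>\<close>.
\<close>

definition ccw_order ::
  "('e \<Rightarrow> real \<Rightarrow> complex) \<Rightarrow> complex \<Rightarrow> 'e edge_end \<Rightarrow> 'e edge_end \<Rightarrow> 'e edge_end \<Rightarrow> bool" where
  "ccw_order \<gamma> v a b c \<longleftrightarrow> (\<forall>\<^sub>F \<rho> in at_right 0.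
     0 < ccw_angle v (exit_point \<gamma> v \<rho> a) (exit_point \<gamma> v \<rho> b) \<and>
     ccw_angle v (exit_point \<gamma> v \<rho> a) (exit_point \<gamma> v \<rho> b)
       < ccw_angle v (exit_point \<gamma> v \<rho> a) (exit_point \<gamma> v \<rho> c))"

text \<open>
  Turning counter-clockwise from a suitable first element \<open>a\<close> of \<open>A\<close>, one meets all of \<open>A\<close> before
  any other end at \<open>v\<close>.
\<close>

definition consecutive_ends ::
  "(complex, 'e) pre_digraph \<Rightarrow> ('e \<Rightarrow> real \<Rightarrow> complex) \<Rightarrow> complex \<Rightarrow> 'e edge_end set \<Rightarrow> bool" where
  "consecutive_ends G \<gamma> v A \<longleftrightarrow> A = {} \<or>
     (\<exists>a\<in>A. \<forall>b\<in>A - {a}. \<forall>c\<in>ends_at G v - A. ccw_order \<gamma> v a b c)"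

text \<open>\<open>b\<close> comes immediately after \<open>a\<close> in the counter-clockwise cyclic order.\<close>

definition ccw_next ::
  "(complex, 'e) pre_digraph \<Rightarrow> ('e \<Rightarrow> real \<Rightarrow> complex) \<Rightarrow> complex \<Rightarrow> 'e edge_end \<Rightarrow> 'e edge_end \<Rightarrow> bool"
  where
  "ccw_next G \<gamma> v a b \<longleftrightarrow> (\<forall>c\<in>ends_at G v - {a, b}. ccw_order \<gamma> v a b c)"

locale plane_balanced_transverse_graph = plane_digraph G \<gamma>
  for G :: "(complex, 'e) pre_digraph" and \<gamma> :: "'e \<Rightarrow> real \<Rightarrow> complex" +
  assumes graph_connected: "Digraph_Component.connected G"
    and balanced: "v \<in> verts G \<Longrightarrow> in_degree G v = out_degree G v"
    and in_consecutive: "v \<in> verts G \<Longrightarrow> consecutive_ends G \<gamma> v (In ` in_arcs G v)"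
    and out_consecutive: "v \<in> verts G \<Longrightarrow> consecutive_ends G \<gamma> v (Out ` out_arcs G v)"


section \<open>Lattice points, oriented spanning trees and clock moves\<close>

text \<open>
  \<open>inc v j\<close> is the \<open>j\<close>-th incoming edge (\<open>1 \<le> j \<le> in_degree G v\<close>) at the non-root vertex \<open>v\<close>, in
  counter-clockwise order and starting with the one preceded by an outgoing edge.
\<close>

definition incoming_labelling ::
  "(complex, 'e) pre_digraph \<Rightarrow> ('e \<Rightarrow> real \<Rightarrow> complex) \<Rightarrow> complex \<Rightarrow> (complex \<Rightarrow> nat \<Rightarrow> 'e) \<Rightarrow> bool"
  where
  "incoming_labelling G \<gamma> r inc \<longleftrightarrow> (\<forall>v \<in> verts G - {r}.
     bij_betw (inc v) {1..in_degree G v} (in_arcs G v) \<and>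
     (\<exists>f \<in> out_arcs G v. ccw_next G \<gamma> v (Out f) (In (inc v 1))) \<and>
     (\<forall>i j. 1 < i \<and> i < j \<and> j \<le> in_degree G v \<longrightarrow>
        ccw_order \<gamma> v (In (inc v 1)) (In (inc v i)) (In (inc v j))))"

text \<open>
  The order of the non-root vertices being immaterial, coordinates are indexed by the vertices
  themselves.
\<close>

definition lattice_points :: "(complex, 'e) pre_digraph \<Rightarrow> complex \<Rightarrow> (complex \<Rightarrow> nat) set" where
  "lattice_points G r = (\<Pi>\<^sub>E v \<in> verts G - {r}. {1..in_degree G v})"

definition represents ::
  "(complex, 'e) pre_digraph \<Rightarrow> complex \<Rightarrow> (complex \<Rightarrow> nat \<Rightarrow> 'e) \<Rightarrow> (complex \<Rightarrow> nat)
     \<Rightarrow> (complex, 'e) pre_digraph \<Rightarrow> bool" where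
  "represents G r inc x H \<longleftrightarrow> spanning H G \<and> arcs H = (\<lambda>v. inc v (x v)) ` (verts G - {r})"

definition neighboring ::
  "(complex, 'e) pre_digraph \<Rightarrow> complex \<Rightarrow> (complex \<Rightarrow> nat) \<Rightarrow> (complex \<Rightarrow> nat) \<Rightarrow> bool" where
  "neighboring G r x x' \<longleftrightarrow> (\<exists>!v. v \<in> verts G - {r} \<and>
     (x v = x' v + 1 \<or> x v + 1 = x' v) \<and> (\<forall>w \<in> verts G - {r} - {v}. x w = x' w))"

text \<open>
  Not \<^const>\<open>spanning_tree\<close>, which has no root and does not prescribe in-degrees.
  \<^const>\<open>pre_digraph.cycle\<close> is an oriented cycle, possibly a loop.
\<close>

definition oriented_spanning_tree ::
  "(complex, 'e) pre_digraph \<Rightarrow> complex \<Rightarrow> (complex, 'e) pre_digraph \<Rightarrow> bool" where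
  "oriented_spanning_tree G r T \<longleftrightarrow> spanning T G \<and>
     (\<forall>v \<in> verts G - {r}. in_degree T v = 1) \<and> in_degree T r = 0 \<and>
     \<not> (\<exists>p. pre_digraph.cycle T p)"

definition clock_move ::
  "(complex, 'e) pre_digraph \<Rightarrow> complex \<Rightarrow> (complex \<Rightarrow> nat \<Rightarrow> 'e)
     \<Rightarrow> (complex, 'e) pre_digraph \<Rightarrow> (complex, 'e) pre_digraph \<Rightarrow> bool" where
  "clock_move G r inc T T' \<longleftrightarrow>
     oriented_spanning_tree G r T \<and> oriented_spanning_tree G r T' \<and>
     (\<exists>x \<in> lattice_points G r. \<exists>x' \<in> lattice_points G r.
        represents G r inc x T \<and> represents G r inc x' T' \<and> neighboring G r x x')"

end

theory Submission
  imports Defs "HOL-Complex_Analysis.Winding_Numbers"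
begin

text \<open>
  Take two trees \<open>x \<noteq> y\<close> and, among the vertices where they differ, one that is deepest in \<open>x\<close>.
  Move its coordinate one step towards \<open>y\<close>. If the result \<open>z\<close> were not a tree, it would contain an
  oriented cycle \<open>C\<close>, which consists of that vertex and descendants of it in \<open>x\<close>, so that \<open>z\<close> lies
  between \<open>x\<close> and \<open>y\<close> on all of \<open>C\<close>. This is impossible: no tree is \<open>\<le> z\<close> on \<open>C\<close> if \<open>C\<close> runs
  counter-clockwise, and none is \<open>\<ge> z\<close> on \<open>C\<close> if it runs clockwise. For in the first case the incoming
  edges with smaller labels at the vertices of \<open>C\<close> arrive from inside \<open>C\<close>, so that following the edges
  of such a tree backwards from \<open>C\<close> one never leaves the closed region bounded by \<open>C\<close>, while the root
  is outside.

  That all edges to the left of \<open>C\<close> lie on the same side is a statement about winding numbers: the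
  winding number of \<open>C\<close> drops by one when \<open>C\<close> is crossed from left to right. Edges being arbitrary
  curves, \<open>C\<close> is first replaced near a vertex by two radii of a small disc.
\<close>

section \<open>Parent maps with coordinates\<close>

text \<open>Following parents reaches the root unless some nonempty set of non-root vertices is
  closed under the parent map. \<open>rooted\<close> is stated through such sets because the region
  trapped by a cycle provides one directly, without a second cycle being extracted from it. The
  labels decide sides because the incoming ends at a vertex are consecutive: no outgoing end
  separates two of them. Turning counter-clockwise from the outgoing end of the cycle, one meets the
  smaller labels, then the cycle's own incoming end, then the larger labels. So smaller labels lie
  to the left of the cycle and larger ones to the right, at every one of its vertices. The obstacle
  is that an edge may cross small circles around its endpoint arbitrarily often, while
  \<open>ccw_order\<close> sees only last exit points. Radii drawn to these points give a local
  picture in which the winding number can be computed. The modified loop is still simple, so its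
  winding number takes just two values, 0 and 1 or -1 and 0; a jump by one then determines the value
  on each side. Away from the disc it agrees with the winding number of the original loop.\<close>

definition rooted :: "'v set \<Rightarrow> ('v \<Rightarrow> 'v) \<Rightarrow> bool" where
  "rooted N p \<longleftrightarrow> \<not> (\<exists>Z\<subseteq>N. Z \<noteq> {} \<and> p ` Z \<subseteq> Z)"

text \<open>A single periodic orbit, encoded without a starting point or a length, so that the
  associated loop can later be started at any of its vertices.\<close>

definition orbit_cycle :: "'v set \<Rightarrow> ('v \<Rightarrow> 'v) \<Rightarrow> 'v set \<Rightarrow> bool" where
  "orbit_cycle N p C \<longleftrightarrow> C \<noteq> {} \<and> C \<subseteq> N \<and> (\<forall>w\<in>C. C = range (\<lambda>i. (p ^^ i) w))"

lemma orbit_cycleD: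
  assumes "orbit_cycle N p C"
  shows "C \<subseteq> N" "C \<noteq> {}"
  using assms by (simp_all add: orbit_cycle_def)

lemma orbit_cycle_closed: "orbit_cycle N p C \<Longrightarrow> w \<in> C \<Longrightarrow> (p ^^ i) w \<in> C"
  unfolding orbit_cycle_def by blast

lemma orbit_cycle_step: "orbit_cycle N p C \<Longrightarrow> w \<in> C \<Longrightarrow> p w \<in> C"
  using orbit_cycle_closed[of N p C w 1] by simp

text \<open>A closed set of least cardinality is such a cycle: the forward orbit of any of its
  points is again closed, hence is the whole set.\<close>

lemma not_rooted_imp_orbit_cycle:
  assumes "finite N" "\<not> rooted N p"
  obtains C where "orbit_cycle N p C"
proof -
  let ?P = "\<lambda>Z. Z \<subseteq> N \<and> Z \<noteq> {} \<and> p ` Z \<subseteq> Z"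
  obtain Z0 where "?P Z0" using assms(2) unfolding rooted_def by blast
  then obtain Z where Z: "?P Z" and min: "\<And>Y. ?P Y \<Longrightarrow> card Z \<le> card Y"
    using ex_has_least_nat[of ?P Z0 card] by auto
  have eq: "Z = range (\<lambda>i. (p ^^ i) w)" if "w \<in> Z" for w
  proof -
    let ?Y = "range (\<lambda>i. (p ^^ i) w)"
    have sub: "?Y \<subseteq> Z"
    proof clarify
      fix i show "(p ^^ i) w \<in> Z" using Z that by (induction i) auto
    qed
    have "p ` ?Y \<subseteq> ?Y"
    proof clarify
      fix i show "p ((p ^^ i) w) \<in> ?Y" by (rule range_eqI[of _ _ "Suc i"]) simp
    qed
    with sub Z have "?P ?Y" by blast
    then have "card Z \<le> card ?Y" by (rule min)
    moreover have "finite Z" using Z assms(1) finite_subset by blast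
    ultimately show ?thesis using sub card_seteq[of Z ?Y] by simp
  qed
  have "orbit_cycle N p Z" unfolding orbit_cycle_def
    by (intro conjI ballI eq) (simp_all add: Z)
  then show ?thesis by (rule that)
qed

lemma orbit_cycle_period:
  assumes "orbit_cycle N p C" "w \<in> C"
  obtains n where "n > 0" "(p ^^ n) w = w" "inj_on (\<lambda>i. (p ^^ i) w) {..<n}"
    "C = (\<lambda>i. (p ^^ i) w) ` {..<n}"
proof -
  \<comment> \<open>Applying the definition at \<open>p w\<close> instead of \<open>w\<close>
    excludes a pre-period: \<open>w\<close> recurs on its own forward orbit.\<close>
  have "C = range (\<lambda>i. (p ^^ i) (p w))"
    using assms orbit_cycle_step[OF assms] unfolding orbit_cycle_def by blast
  then obtain i where "w = (p ^^ i) (p w)" using assms(2) by blast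
  then have ex: "\<exists>n. n > 0 \<and> (p ^^ n) w = w"
    by (intro exI[of _ "Suc i"]) (simp add: funpow_swap1)
  define n where "n = (LEAST n. n > 0 \<and> (p ^^ n) w = w)"
  have n: "n > 0" "(p ^^ n) w = w" using LeastI_ex[OF ex] unfolding n_def by auto
  have least: "n \<le> m" if "m > 0" "(p ^^ m) w = w" for m
    unfolding n_def using that by (intro Least_le) auto
  have inj: "inj_on (\<lambda>i. (p ^^ i) w) {..<n}"
  proof (rule linorder_inj_onI')
    fix i j assume ij: "i \<in> {..<n}" "j \<in> {..<n}" "i < j"
    show "(p ^^ i) w \<noteq> (p ^^ j) w"
    proof
      assume eq: "(p ^^ i) w = (p ^^ j) w"
      \<comment> \<open>Moving both equal iterates forward by n - j yields the period n - j + i,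
        which is smaller than n.\<close>
      have "(p ^^ (n - j + i)) w = (p ^^ (n - j)) ((p ^^ j) w)"
        by (simp add: funpow_add eq)
      also have "\<dots> = (p ^^ (n - j + j)) w" by (simp add: funpow_add)
      finally have "(p ^^ (n - j + i)) w = w" using ij n by simp
      with least[of "n - j + i"] ij show False by simp
    qed
  qed
  have "(p ^^ i) w \<in> (\<lambda>i. (p ^^ i) w) ` {..<n}" for i
    using n by (intro image_eqI[of _ _ "i mod n"]) (simp_all add: funpow_mod_eq)
  moreover have "C = range (\<lambda>i. (p ^^ i) w)" using assms unfolding orbit_cycle_def by blast
  ultimately have "C = (\<lambda>i. (p ^^ i) w) ` {..<n}" by blast
  with n inj show ?thesis by (rule that)
qed

text \<open>The rank is the depth in the tree, the number of steps needed to leave \<open>N\<close>.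
  It is finite because an orbit that stays in \<open>N\<close> would be a closed set.\<close>

lemma rooted_rank:
  assumes "rooted N p"
  shows "\<exists>d :: 'v \<Rightarrow> nat. \<forall>v\<in>N. d (p v) < d v"
proof -
  define d where "d v = (LEAST i. (p ^^ i) v \<notin> N)" for v
  have "d (p v) < d v" if "v \<in> N" for v
  proof -
    have "\<exists>i. (p ^^ i) v \<notin> N"
    proof (rule ccontr)
      assume "\<nexists>i. (p ^^ i) v \<notin> N"
      then have "range (\<lambda>i. (p ^^ i) v) \<subseteq> N" by blast
      moreover have "p ` range (\<lambda>i. (p ^^ i) v) \<subseteq> range (\<lambda>i. (p ^^ i) v)"
      proof clarify
        fix i show "p ((p ^^ i) v) \<in> range (\<lambda>i. (p ^^ i) v)"
          by (rule range_eqI[of _ _ "Suc i"]) simp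
      qed
      ultimately show False using assms unfolding rooted_def by blast
    qed
    then have out: "(p ^^ d v) v \<notin> N" unfolding d_def by (rule LeastI_ex)
    with that obtain m where m: "d v = Suc m" by (cases "d v") auto
    then have "(p ^^ m) (p v) \<notin> N" using out by (simp add: funpow_swap1)
    then have "d (p v) \<le> m" unfolding d_def by (rule Least_le)
    then show ?thesis using m by simp
  qed
  then show ?thesis by blast
qed

text \<open>Only the parent of \<open>v\<close> has been changed, so from any other member the new
  cycle follows old parents, and the rank drops, until it arrives at \<open>v\<close>.\<close>

lemma orbit_cycle_rank:
  assumes C: "orbit_cycle N p' C" and v: "v \<in> C" and u: "u \<in> C" "u \<noteq> v"
    and eq: "\<And>w. w \<noteq> v \<Longrightarrow> p' w = p w"
    and d: "\<And>w. w \<in> N \<Longrightarrow> (d (p w) :: nat) < d w"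
  shows "d v < d u"
proof -
  have *: "w = v \<or> d v < d w" if "w \<in> C" "(p' ^^ n) w = v" for n w
    using that
  proof (induction n arbitrary: w)
    case (Suc n)
    have "w = v \<or> d v < d w" if "w \<noteq> v"
    proof -
      have "p w \<in> C" using orbit_cycle_step[OF C Suc.prems(1)] eq that by simp
      moreover have "(p' ^^ n) (p w) = v" using Suc.prems(2) eq that by (simp add: funpow_swap1)
      ultimately have "p w = v \<or> d v < d (p w)" by (rule Suc.IH)
      moreover have "d (p w) < d w" using d C Suc.prems(1) unfolding orbit_cycle_def by blast
      ultimately show ?thesis by auto
    qed
    then show ?case by blast
  qed simp
  have "C = range (\<lambda>i. (p' ^^ i) u)" using C u(1) unfolding orbit_cycle_def by blast
  with v obtain n where "(p' ^^ n) u = v" by (metis imageE)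
  with * u show ?thesis by blast
qed

section \<open>Connecting trees by unit steps, with planarity abstracted into one hypothesis on
  cycles\<close>

locale coordinate_parents =
  fixes N :: "'v set" and deg :: "'v \<Rightarrow> nat" and par :: "'v \<Rightarrow> nat \<Rightarrow> 'v"
  assumes finite_N: "finite N"
begin

definition "points = (\<Pi>\<^sub>E v\<in>N. {1..deg v})"
definition "parent x v = par v (x v)"

definition tree :: "('v \<Rightarrow> nat) \<Rightarrow> bool" where
  "tree x \<longleftrightarrow> x \<in> points \<and> rooted N (parent x)"

definition adjacent :: "('v \<Rightarrow> nat) \<Rightarrow> ('v \<Rightarrow> nat) \<Rightarrow> bool" where
  "adjacent x y \<longleftrightarrow> (\<exists>v\<in>N. (x v = y v + 1 \<or> x v + 1 = y v) \<and> (\<forall>w\<in>N - {v}. x w = y w))"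

text \<open>Planarity enters through \<open>side\<close> alone. Its quantifier order matters: one of
  the two bounds on \<open>C\<close> excludes all trees at once. As \<open>x\<close> and
  \<open>y\<close> bound \<open>z\<close> on \<open>C\<close> from opposite sides, one of the two
  trees is contradicted whichever bound it is.\<close>

lemma tree_step:
  assumes side: "\<And>z C. \<lbrakk>z \<in> points; orbit_cycle N (parent z) C\<rbrakk> \<Longrightarrow>
      (\<forall>y. tree y \<longrightarrow> (\<exists>w\<in>C. z w < y w)) \<or> (\<forall>y. tree y \<longrightarrow> (\<exists>w\<in>C. y w < z w))"
    and x: "tree x" and y: "tree y" and "x \<noteq> y"
  obtains z where "tree z" "adjacent x z"
    "(\<Sum>v\<in>N. \<bar>int (z v) - int (y v)\<bar>) < (\<Sum>v\<in>N. \<bar>int (x v) - int (y v)\<bar>)"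
proof -
  have "rooted N (parent x)" using x unfolding tree_def by blast
  then obtain d :: "'v \<Rightarrow> nat" where d: "\<And>v. v \<in> N \<Longrightarrow> d (parent x v) < d v"
    using rooted_rank by blast
  let ?D = "{v \<in> N. x v \<noteq> y v}"
  have xp: "x \<in> points" and yp: "y \<in> points" using x y unfolding tree_def by auto
  then have "?D \<noteq> {}" using \<open>x \<noteq> y\<close> unfolding points_def by (auto intro: PiE_ext)
  moreover have fin: "finite ?D" using finite_N by simp
  ultimately have "Max (d ` ?D) \<in> d ` ?D" by (intro Max_in) auto
  then obtain v where v: "v \<in> ?D" "d v = Max (d ` ?D)" by auto
  have max: "d u \<le> d v" if "u \<in> ?D" for u
    unfolding v(2) using fin that by (intro Max_ge) auto
  \<comment> \<open>In the second case \<open>y v < x v\<close>, so the subtraction of natural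
    numbers is exact and the coordinate stays at least 1.\<close>
  define z where "z = x(v := if x v < y v then x v + 1 else x v - 1)"
  have bnd: "1 \<le> x v" "x v \<le> deg v" "1 \<le> y v" "y v \<le> deg v" "x v \<noteq> y v" "v \<in> N"
    using xp yp v unfolding points_def by (auto simp: PiE_iff)
  then have zp: "z \<in> points" using xp unfolding points_def z_def by (auto simp: PiE_iff extensional_def)
  have adj: "adjacent x z" unfolding adjacent_def z_def using bnd by (intro bexI[of _ v]) auto
  have rooted: "rooted N (parent z)"
  proof (rule ccontr)
    assume "\<not> rooted N (parent z)"
    then obtain C where C: "orbit_cycle N (parent z) C"
      using not_rooted_imp_orbit_cycle finite_N by blast
    have eq: "parent z w = parent x w" if "w \<noteq> v" for w using that by (simp add: parent_def z_def)
    have vC: "v \<in> C"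
    proof (rule ccontr)
      assume "v \<notin> C"
      then have "parent x ` C \<subseteq> C" using orbit_cycle_step[OF C] eq by fastforce
      then show False using x C unfolding tree_def rooted_def orbit_cycle_def by blast
    qed
    have "x u = y u" if "u \<in> C" "u \<noteq> v" for u
    proof -
      have "d v < d u" using orbit_cycle_rank[OF C vC that, of "parent x" d] eq d by blast
      moreover have "u \<in> N" using C that unfolding orbit_cycle_def by blast
      ultimately show ?thesis using max[of u] by auto
    qed
    then have "(\<forall>w\<in>C. x w \<le> z w) \<and> (\<forall>w\<in>C. z w \<le> y w) \<or> (\<forall>w\<in>C. z w \<le> x w) \<and> (\<forall>w\<in>C. y w \<le> z w)"
      using bnd by (cases "x v < y v") (auto simp: z_def)
    then show False using side[OF zp C] x y by (metis linorder_not_less)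
  qed
  have "(\<Sum>v\<in>N. \<bar>int (z v) - int (y v)\<bar>) < (\<Sum>v\<in>N. \<bar>int (x v) - int (y v)\<bar>)"
    by (rule sum_strict_mono_ex1) (use finite_N bnd in \<open>auto simp: z_def intro!: bexI[of _ v]\<close>)
  with rooted zp adj show ?thesis using that unfolding tree_def by blast
qed

theorem trees_connected:
  assumes side: "\<And>z C. \<lbrakk>z \<in> points; orbit_cycle N (parent z) C\<rbrakk> \<Longrightarrow>
      (\<forall>y. tree y \<longrightarrow> (\<exists>w\<in>C. z w < y w)) \<or> (\<forall>y. tree y \<longrightarrow> (\<exists>w\<in>C. y w < z w))"
    and "tree x" "tree y"
  shows "(\<lambda>x y. tree x \<and> tree y \<and> adjacent x y)\<^sup>*\<^sup>* x y"
  using assms(2)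
proof (induction "nat (\<Sum>v\<in>N. \<bar>int (x v) - int (y v)\<bar>)" arbitrary: x rule: less_induct)
  case less
  show ?case
  proof (cases "x = y")
    case False
    from tree_step[OF side less.prems \<open>tree y\<close> False] obtain z where z: "tree z" "adjacent x z"
      and lt: "(\<Sum>v\<in>N. \<bar>int (z v) - int (y v)\<bar>) < (\<Sum>v\<in>N. \<bar>int (x v) - int (y v)\<bar>)" by blast
    have "0 \<le> (\<Sum>v\<in>N. \<bar>int (z v) - int (y v)\<bar>)" by (simp add: sum_nonneg)
    with lt have "0 < (\<Sum>v\<in>N. \<bar>int (x v) - int (y v)\<bar>)" by linarith
    with lt have "nat (\<Sum>v\<in>N. \<bar>int (z v) - int (y v)\<bar>) < nat (\<Sum>v\<in>N. \<bar>int (x v) - int (y v)\<bar>)" by simp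
    from less.hyps[OF this z(1)] z less.prems show ?thesis
      by (simp add: converse_rtranclp_into_rtranclp)
  qed simp
qed

end

section \<open>The winding number near a wedge\<close>

text \<open>
  Replacing the radii by the chords \<open>E \<rightarrow> Q \<rightarrow> F\<close> yields a loop that does not separate \<open>pL\<close> from \<open>pR\<close>.
  The difference of the two loops is the sum of the boundaries of the triangles \<open>w F Q\<close> and \<open>w Q E\<close>;
  both points are outside of them, except that \<open>pL\<close> is inside the first one.
\<close>

lemma wedge_jump:
  fixes w u :: complex and \<rho> x y :: real
  defines "F \<equiv> w + u * Complex x (-y)" and "E \<equiv> w + u * Complex x y" and "Q \<equiv> w + u * of_real \<rho>"
  defines "pL \<equiv> w + (F - w) / 4 + (Q - w) / 4" and "pR \<equiv> w - u * of_real (\<rho> / 2)"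
  assumes u: "cmod u = 1" and \<rho>: "\<rho> > 0" and y: "y > 0" and xy: "x\<^sup>2 + y\<^sup>2 = \<rho>\<^sup>2"
    and R: "path R" "pathstart R = F" "pathfinish R = E" "path_image R \<inter> ball w \<rho> = {}"
  shows "winding_number (linepath w F +++ R +++ linepath E w) pL
       = winding_number (linepath w F +++ R +++ linepath E w) pR + 1"
proof -
  \<comment> \<open>Coordinates in the frame with origin \<open>w\<close> and first axis
    \<open>u\<close>, the bisector of the wedge: the radii end at (x, -y) and (x, y), and
    \<open>Q\<close> is the point of the circle on the bisector.\<close>
  define X where "X z = Re ((z - w) * cnj u)" for z
  define Y where "Y z = Im ((z - w) * cnj u)" for z
  have uu: "u * cnj u = 1" using u by (simp add: complex_norm_square[symmetric])
  then have ru: "(u * a) * cnj u = a" for a by (simp add: mult.assoc mult.left_commute)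
  have coord: "X w = 0" "Y w = 0" "X F = x" "Y F = - y" "X E = x" "Y E = y" "X Q = \<rho>" "Y Q = 0"
    unfolding X_def Y_def F_def E_def Q_def by (simp_all add: ru)
  have XY_lin: "X (w + of_real a * (p - w) + of_real b * (q - w)) = a * X p + b * X q"
       "Y (w + of_real a * (p - w) + of_real b * (q - w)) = a * Y p + b * Y q" for a b p q
    unfolding X_def Y_def by (simp_all add: algebra_simps)
  \<comment> \<open>\<open>pL\<close> has barycentric weights 1/2, 1/4, 1/4 in the triangle
    \<open>w F Q\<close>, so it is interior for every opening angle; \<open>pR\<close> lies on the
    ray opposite to the bisector, halfway to the circle.\<close>
  have pL: "X pL = (x + \<rho>) / 4" "Y pL = - y / 4"
    using XY_lin[of "1/4" F "1/4" Q] coord unfolding pL_def by (simp_all add: field_simps)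
  have pR: "X pR = - \<rho> / 2" "Y pR = 0"
    using XY_lin[of "-1/2" Q 0 w] coord unfolding pR_def Q_def by (simp_all add: field_simps)
  have seg: "\<exists>t. 0 \<le> t \<and> t \<le> 1 \<and> X z = (1 - t) * X a + t * X b \<and> Y z = (1 - t) * Y a + t * Y b"
    if "z \<in> closed_segment a b" for z a b
  proof -
    from that obtain t where t: "0 \<le> t" "t \<le> 1" "z = (1 - t) *\<^sub>R a + t *\<^sub>R b"
      by (auto simp: in_segment)
    have "z - w = of_real (1 - t) * (a - w) + of_real t * (b - w)"
      unfolding t(3) by (simp add: scaleR_conv_of_real algebra_simps)
    then have "z = w + of_real (1 - t) * (a - w) + of_real t * (b - w)" by (simp add: algebra_simps)
    with XY_lin t show ?thesis by metis
  qed
  have norms: "cmod (F - w) = \<rho>" "cmod (Q - w) = \<rho>"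
    using u xy \<rho> unfolding F_def Q_def by (simp_all add: norm_mult complex_norm)
  have balls: "closed_segment w pL \<subseteq> ball w \<rho>" "closed_segment w pR \<subseteq> ball w \<rho>"
  proof -
    have "cmod (pL - w) \<le> cmod ((F - w) / 4) + cmod ((Q - w) / 4)"
      unfolding pL_def by (metis add.assoc add_diff_cancel_left' norm_triangle_ineq)
    also have "\<dots> < \<rho>" using norms \<rho> by (simp add: norm_divide)
    finally have "pL \<in> ball w \<rho>" by (simp add: dist_norm norm_minus_commute)
    moreover have "pR \<in> ball w \<rho>" using \<rho> u unfolding pR_def by (simp add: dist_norm norm_mult)
    ultimately show "closed_segment w pL \<subseteq> ball w \<rho>" "closed_segment w pR \<subseteq> ball w \<rho>"
      using \<rho> by (simp_all add: closed_segment_subset)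
  qed
  \<comment> \<open>The two segments meet at \<open>w\<close>, so their union is a connected set
    joining \<open>pL\<close> to \<open>pR\<close>; once it avoids the chords, the winding number of
    the chord loop agrees at both points.\<close>
  have chords: "z \<notin> closed_segment E Q \<and> z \<notin> closed_segment F Q"
    if z: "z \<in> closed_segment w pL \<union> closed_segment w pR" for z
  proof -
    have EQ: "Y z = 0 \<longrightarrow> X z = \<rho>" "Y z \<ge> 0" if "z \<in> closed_segment E Q"
      using seg[OF that] y unfolding coord by auto
    have FQ2: "\<exists>t. 0 \<le> t \<and> t \<le> 1 \<and> X z = (1 - t) * x + t * \<rho> \<and> Y z = - ((1 - t) * y)"
      if "z \<in> closed_segment F Q"
      using seg[OF that] unfolding coord by simp
    then have FQ: "Y z = 0 \<longrightarrow> X z = \<rho>" if "z \<in> closed_segment F Q"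
      using that y by fastforce
    show ?thesis
    proof (cases "z \<in> closed_segment w pR")
      case True
      then have "X z \<le> 0" "Y z = 0" using seg[OF True] pR coord \<rho> by auto
      then show ?thesis using EQ FQ \<rho> by auto
    next
      case False
      with z have "z \<in> closed_segment w pL" by blast
      from seg[OF this] obtain s where s: "0 \<le> s" "s \<le> 1" "X z = s * ((x + \<rho>) / 4)" "Y z = - s * y / 4"
        using pL coord by auto
      have "z \<notin> closed_segment E Q"
      proof
        assume a: "z \<in> closed_segment E Q"
        then have "s * y \<le> 0" using EQ(2) s by auto
        then have "s = 0" using s(1) y by (simp add: mult_le_0_iff)
        then show False using EQ(1)[OF a] s \<rho> by simp
      qed
      moreover have "z \<notin> closed_segment F Q"
      proof
        assume a: "z \<in> closed_segment F Q"
        from FQ2[OF this] obtain t where t: "0 \<le> t" "t \<le> 1" "X z = (1 - t) * x + t * \<rho>" "Y z = - ((1 - t) * y)"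
          by blast
        have "(s / 4) * y = (1 - t) * y" using t(4) s(4) by (simp add: algebra_simps)
        then have "1 - t = s / 4" using y by simp
        then have "t = 1 - s / 4" by simp
        then have "s / 4 * x + (1 - s / 4) * \<rho> = s * ((x + \<rho>) / 4)" using t(3) s(3) by simp
        then have "(1 - s / 2) * \<rho> = 0" by (simp add: algebra_simps)
        then show False using \<rho> s(2) by simp
      qed
      ultimately show ?thesis by blast
    qed
  qed
  have radii: "p \<notin> closed_segment w F \<and> p \<notin> closed_segment E w \<and> p \<notin> closed_segment w Q"
    if "p \<in> {pL, pR}" for p
  proof (cases "p = pR")
    case True
    have "t * y \<noteq> 0 \<or> t = 0" for t using y by simp
    then show ?thesis using seg[of p w F] seg[of p E w] seg[of p w Q] coord pR \<rho> True
      by (smt (verit) mult_eq_0_iff mult_nonneg_nonneg minus_mult_right divide_neg_pos)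
  next
    case False
    then have p: "p = pL" using that by blast
    have "p \<notin> closed_segment w F"
    proof
      assume "p \<in> closed_segment w F"
      from seg[OF this] obtain t where t: "(x + \<rho>) / 4 = t * x" "- y / 4 = - t * y"
        using coord pL p by auto
      from t(2) have "(1/4) * y = t * y" by simp
      then have "t = 1 / 4" using y by simp
      then have "x + \<rho> = x" using t(1) by simp
      then show False using \<rho> by simp
    qed
    moreover have "p \<notin> closed_segment E w"
      using seg[of p E w] coord pL p y by (smt (verit) mult_nonneg_nonneg divide_neg_pos mult_zero_right)
    moreover have "p \<notin> closed_segment w Q"
      using seg[of p w Q] coord pL p y by auto
    ultimately show ?thesis by blast
  qed
  define CQ where "CQ = R +++ (linepath E Q +++ linepath Q F)"
  \<comment> \<open>Two triangles instead of the single one \<open>w F E\<close>: the opening angle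
    may be pi or more, with x <= 0, whereas each half of the wedge has an angle below pi.\<close>
  define T1 where "T1 = linepath w F +++ linepath F Q +++ linepath Q w"
  define T2 where "T2 = linepath w Q +++ linepath Q E +++ linepath E w"
  have dec: "winding_number (linepath w F +++ R +++ linepath E w) p
      = winding_number CQ p + winding_number T1 p + winding_number T2 p" if p: "p \<in> {pL, pR}" for p
  proof -
    have 1: "p \<notin> closed_segment w F" "p \<notin> closed_segment E w" "p \<notin> closed_segment w Q"
      using radii p by auto
    have 2: "p \<notin> closed_segment E Q" "p \<notin> closed_segment F Q" using chords[of p] p by auto
    have 3: "p \<notin> path_image R" using R(4) balls p by auto
    have rev: "winding_number (linepath b a) p = - winding_number (linepath a b) p"
      if "p \<notin> closed_segment a b" for a b
      using winding_number_reversepath[of "linepath a b" p] that by simp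
    have "winding_number (linepath w F +++ R +++ linepath E w) p
        = winding_number (linepath w F) p + winding_number R p + winding_number (linepath E w) p"
      using 1 3 R by (simp add: winding_number_join path_image_join)
    moreover have "winding_number CQ p = winding_number R p + winding_number (linepath E Q) p + winding_number (linepath Q F) p"
      unfolding CQ_def using 2 3 R by (simp add: winding_number_join path_image_join closed_segment_commute)
    moreover have "winding_number T1 p = winding_number (linepath w F) p + winding_number (linepath F Q) p + winding_number (linepath Q w) p"
      unfolding T1_def using 1 2 by (simp add: winding_number_join path_image_join closed_segment_commute)
    moreover have "winding_number T2 p = winding_number (linepath w Q) p + winding_number (linepath Q E) p + winding_number (linepath E w) p"
      unfolding T2_def using 1 2 by (simp add: winding_number_join path_image_join closed_segment_commute)
    ultimately show ?thesis
      using rev[of w Q] rev[of E Q] rev[of F Q] 1 2 by simp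
  qed
  have "winding_number CQ pL = winding_number CQ pR"
  proof (rule winding_number_eq)
    show "Topological_Spaces.connected (closed_segment w pL \<union> closed_segment w pR)"
      by (rule connected_Un) auto
    show "(closed_segment w pL \<union> closed_segment w pR) \<inter> path_image CQ = {}"
      using chords balls R unfolding CQ_def
      by (auto simp: path_image_join closed_segment_commute)
  qed (use R in \<open>auto simp: CQ_def\<close>)
  moreover have hull: "\<exists>s t. 0 \<le> s \<and> 0 \<le> t \<and> X p = s * X a + t * X b \<and> Y p = s * Y a + t * Y b"
    if "p \<in> convex hull {w, a, b}" for p a b
  proof -
    from that obtain r s t where t: "0 \<le> s" "0 \<le> t" "r + s + t = 1" "p = r *\<^sub>R w + s *\<^sub>R a + t *\<^sub>R b"
      by (auto simp: convex_hull_3)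
    have r: "r = 1 - s - t" using t by simp
    have "p = w + of_real s * (a - w) + of_real t * (b - w)"
      unfolding t(4) r by (simp add: scaleR_conv_of_real algebra_simps)
    with XY_lin t show ?thesis by metis
  qed
  have zero: "winding_number (linepath a b +++ linepath b c +++ linepath c a) p = 0"
    if "p \<notin> convex hull {a, b, c}" for a b c p
  proof (rule winding_number_zero_outside[of _ "convex hull {a, b, c}"])
    show "path_image (linepath a b +++ linepath b c +++ linepath c a) \<subseteq> convex hull {a, b, c}"
      by (auto simp: path_image_join segment_convex_hull intro: hull_mono[THEN subsetD, rotated])
  qed (use that in auto)
  have "winding_number T2 pL = 0"
  proof -
    have "pL \<notin> convex hull {w, Q, E}"
      using hull[of pL Q E] coord pL y by (smt (verit) divide_neg_pos mult_nonneg_nonneg)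
    then show ?thesis unfolding T2_def by (rule zero)
  qed
  moreover have "winding_number T2 pR = 0"
  proof -
    have "pR \<notin> convex hull {w, Q, E}"
    proof
      assume "pR \<in> convex hull {w, Q, E}"
      from hull[OF this] obtain s t where "0 \<le> s" "- \<rho> / 2 = s * \<rho> + t * x" "t * y = 0"
        using coord pR by auto
      then show False using y \<rho> by (smt (verit) mult_eq_0_iff mult_nonneg_nonneg divide_neg_pos)
    qed
    then show ?thesis unfolding T2_def by (rule zero)
  qed
  moreover have "winding_number T1 pR = 0"
  proof -
    have "pR \<notin> convex hull {w, F, Q}"
    proof
      assume "pR \<in> convex hull {w, F, Q}"
      from hull[OF this] obtain s t where "0 \<le> t" "- \<rho> / 2 = s * x + t * \<rho>" "s * y = 0"
        using coord pR by auto
      then show False using y \<rho> by (smt (verit) mult_eq_0_iff mult_nonneg_nonneg divide_neg_pos)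
    qed
    then show ?thesis unfolding T1_def by (rule zero)
  qed
  moreover have "winding_number T1 pL = 1"
  proof -
    have "\<not> collinear {w, F, Q}"
    proof
      assume "collinear {w, F, Q}"
      then obtain e where e: "\<And>a b. a \<in> {w, F, Q} \<Longrightarrow> b \<in> {w, F, Q} \<Longrightarrow> \<exists>c. a - b = c *\<^sub>R e"
        unfolding collinear_def by blast
      obtain c d where cd: "F - w = c *\<^sub>R e" "Q - w = d *\<^sub>R e" using e[of F w] e[of Q w] by auto
      have "X F * Y Q = Y F * X Q" unfolding X_def Y_def cd by (simp add: algebra_simps)
      then show False using coord y \<rho> by auto
    qed
    moreover have "pL = (1/2) *\<^sub>R w + (1/4) *\<^sub>R F + (1/4) *\<^sub>R Q"
      unfolding pL_def by (simp add: scaleR_conv_of_real field_simps)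
    ultimately have "pL \<in> interior (convex hull {w, F, Q})"
      unfolding interior_convex_hull_3_minimal[OF \<open>\<not> collinear {w, F, Q}\<close> DIM_complex]
      by (intro CollectI) (rule exI[of _ "1/2"], rule exI[of _ "1/4"], rule exI[of _ "1/4"], simp)
    \<comment> \<open>The sign criterion of \<open>winding_number_triangle\<close>: the triangle
      \<open>w F Q\<close> is traversed counter-clockwise, so the value is 1 and not -1.\<close>
    moreover have "0 < Im ((F - w) * cnj (F - pL))"
    proof -
      have Fw: "F - w = u * Complex x (- y)" unfolding F_def by simp
      have FpL: "F - pL = u * (Complex ((3 * x - \<rho>) / 4) (- 3 * y / 4))"
        unfolding pL_def F_def Q_def by (simp add: complex_eq_iff field_simps)
      have "(F - w) * cnj (F - pL)
         = (u * cnj u) * (Complex x (- y) * cnj (Complex ((3 * x - \<rho>) / 4) (- 3 * y / 4)))"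
        unfolding FpL Fw by (simp only: complex_cnj_mult mult_ac)
      then have im: "Im ((F - w) * cnj (F - pL)) = y * \<rho> / 4" using uu by (simp add: field_simps)
      show ?thesis unfolding im using y \<rho> by simp
    qed
    ultimately show ?thesis unfolding T1_def by (simp add: winding_number_triangle)
  qed
  ultimately show ?thesis using dec[of pL] dec[of pR] by simp
qed

section \<open>Counter-clockwise angles between points of a circle\<close>

lemma ccw_angle_bounds: "0 \<le> ccw_angle w p q" "ccw_angle w p q < 2 * pi"
  unfolding ccw_angle_def by (rule Arg2pi_ge_0, rule Arg2pi_lt_2pi)

lemma ccw_angle_cis:
  assumes "cmod (p - w) = cmod (q - w)" "p \<noteq> w"
  shows "q = w + (p - w) * cis (ccw_angle w p q)"
proof -
  have "(q - w) / (p - w) = cis (ccw_angle w p q)"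
    using Arg2pi_eq[of "(q - w) / (p - w)"] assms unfolding ccw_angle_def
    by (auto simp: norm_divide cis_conv_exp split: if_splits)
  then show ?thesis using assms by (simp add: field_simps)
qed

lemma ccw_angle_eqI:
  assumes "q = w + (p - w) * cis \<phi>" "p \<noteq> w" "0 \<le> \<phi>" "\<phi> < 2 * pi"
  shows "ccw_angle w p q = \<phi>"
  unfolding ccw_angle_def
  by (rule Arg2pi_unique[of 1]) (use assms in \<open>auto simp: cis_conv_exp\<close>)

lemma ccw_angle_diff:
  assumes "cmod (p - w) = cmod (q - w)" "cmod (p - w) = cmod (a - w)" "p \<noteq> w"
    and "ccw_angle w p q < ccw_angle w p a"
  shows "ccw_angle w q a = ccw_angle w p a - ccw_angle w p q"
    "ccw_angle w a q = 2 * pi - (ccw_angle w p a - ccw_angle w p q)"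
proof -
  let ?\<alpha> = "ccw_angle w p q" and ?\<beta> = "ccw_angle w p a"
  have ne: "q \<noteq> w" "a \<noteq> w" using assms by auto
  have q: "q - w = (p - w) * cis ?\<alpha>" using ccw_angle_cis[OF assms(1,3)] by (metis add_diff_cancel_left')
  have a: "a - w = (p - w) * cis ?\<beta>" using ccw_angle_cis[OF assms(2,3)] by (metis add_diff_cancel_left')
  have bnd: "?\<beta> < 2 * pi" "0 \<le> ?\<alpha>" by (rule ccw_angle_bounds)+
  have "a - w = (q - w) * cis (?\<beta> - ?\<alpha>)" unfolding q a by (simp add: mult.assoc cis_mult)
  then have "a = w + (q - w) * cis (?\<beta> - ?\<alpha>)" by (simp add: algebra_simps)
  then show "ccw_angle w q a = ?\<beta> - ?\<alpha>" using assms ne bnd by (intro ccw_angle_eqI) auto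
  have "cis (2 * pi - (?\<beta> - ?\<alpha>)) = cis (?\<alpha> - ?\<beta>)" by (simp add: complex_eq_iff cos_diff sin_diff)
  then have "q - w = (a - w) * cis (2 * pi - (?\<beta> - ?\<alpha>))" unfolding q a by (simp add: mult.assoc cis_mult)
  then have "q = w + (a - w) * cis (2 * pi - (?\<beta> - ?\<alpha>))" by (simp add: algebra_simps)
  then show "ccw_angle w a q = 2 * pi - (?\<beta> - ?\<alpha>)" using assms ne bnd by (intro ccw_angle_eqI) auto
qed

lemma ccw_angle_refl: "p \<noteq> w \<Longrightarrow> ccw_angle w p p = 0"
  by (rule ccw_angle_eqI) auto

text \<open>This is what makes the condition inside \<open>ccw_order\<close> cyclic: it may be read
  from any of the three points.\<close>

lemma ccw_angle_cyclic:
  assumes "cmod (p - w) = \<rho>" "cmod (q - w) = \<rho>" "cmod (a - w) = \<rho>" "\<rho> > 0"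
    and "0 < ccw_angle w p q" "ccw_angle w p q < ccw_angle w p a"
  shows "0 < ccw_angle w q a" "ccw_angle w q a < ccw_angle w q p"
proof -
  have p: "p \<noteq> w" "ccw_angle w p p = 0" using assms ccw_angle_refl[of p w] by auto
  have "ccw_angle w q a = ccw_angle w p a - ccw_angle w p q"
    using assms p by (intro ccw_angle_diff) auto
  moreover have "ccw_angle w q p = 2 * pi - (ccw_angle w p q - ccw_angle w p p)"
    using assms p by (intro ccw_angle_diff) auto
  ultimately show "0 < ccw_angle w q a" "ccw_angle w q a < ccw_angle w q p"
    using assms p ccw_angle_bounds(2)[of w p a] by auto
qed

text \<open>The apex is left out because it lies on the loop; the outer arc (s = 1) is kept because
  exit points lie on it.\<close>

definition sector :: "complex \<Rightarrow> complex \<Rightarrow> real \<Rightarrow> real \<Rightarrow> complex set" where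
  "sector w z \<alpha> \<beta> = (\<lambda>(s, \<phi>). w + of_real s * z * cis \<phi>) ` ({0<..1} \<times> {\<alpha><..<\<beta>})"

lemma connected_sector: "Topological_Spaces.connected (sector w z \<alpha> \<beta>)"
  unfolding sector_def
  by (intro connected_continuous_image convex_connected convex_Times)
    (auto simp: case_prod_unfold intro!: continuous_intros continuous_on_cis)

lemma sectorI: "0 < s \<Longrightarrow> s \<le> 1 \<Longrightarrow> \<alpha> < \<phi> \<Longrightarrow> \<phi> < \<beta> \<Longrightarrow> w + of_real s * z * cis \<phi> \<in> sector w z \<alpha> \<beta>"
  unfolding sector_def by (intro image_eqI[of _ _ "(s, \<phi>)"]) auto

lemma sectorE:
  assumes "p \<in> sector w z \<alpha> \<beta>"
  obtains s \<phi> where "0 < s" "s \<le> 1" "\<alpha> < \<phi>" "\<phi> < \<beta>" "p = w + of_real s * z * cis \<phi>"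
  using assms unfolding sector_def by auto

lemma cis_eq_real_multiple:
  assumes "of_real s * cis \<phi> = of_real t * cis \<theta>" "0 < s" "0 \<le> t" "0 \<le> \<phi>" "\<phi> < 2 * pi" "0 \<le> \<theta>" "\<theta> < 2 * pi"
  shows "s = t \<and> \<phi> = \<theta>"
proof -
  have "cmod (of_real s * cis \<phi>) = cmod (of_real t * cis \<theta>)" using assms(1) by simp
  then have "\<bar>s\<bar> = \<bar>t\<bar>" unfolding norm_mult norm_of_real norm_cis by simp
  then have st: "s = t" using assms(2,3) by simp
  then have "cis \<phi> = cis \<theta>" using assms by simp
  then have "Arg2pi (cis \<phi>) = Arg2pi (cis \<theta>)" by simp
  moreover have "Arg2pi (cis \<phi>) = \<phi>" "Arg2pi (cis \<theta>) = \<theta>"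
    using assms by (auto intro!: Arg2pi_unique[of 1] simp: cis_conv_exp)
  ultimately show ?thesis using st by simp
qed

text \<open>\<open>wedge_jump\<close> compares just two sample points. They lie in the two sectors
  cut out by the radii, and each sector is connected and disjoint from the loop, which carries the
  two values to all points of the open arcs.\<close>

lemma wedge_sides:
  fixes w F E :: complex and \<rho> :: real
  defines "C \<equiv> \<lambda>R. linepath w F +++ R +++ linepath E w"
  assumes \<rho>: "\<rho> > 0" and F: "cmod (F - w) = \<rho>" and E: "cmod (E - w) = \<rho>"
    and ang: "0 < ccw_angle w F E"
    and R: "path R" "pathstart R = F" "pathfinish R = E" "path_image R \<inter> cball w \<rho> \<subseteq> {E, F}"
  obtains pL pR where
    "pL \<notin> path_image (C R)" "pR \<notin> path_image (C R)"
    "winding_number (C R) pL = winding_number (C R) pR + 1"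
    "\<And>p. \<lbrakk>cmod (p - w) = \<rho>; 0 < ccw_angle w F p; ccw_angle w F p < ccw_angle w F E\<rbrakk>
       \<Longrightarrow> p \<notin> path_image (C R) \<and> winding_number (C R) p = winding_number (C R) pL"
    "\<And>p. \<lbrakk>cmod (p - w) = \<rho>; ccw_angle w F E < ccw_angle w F p\<rbrakk>
       \<Longrightarrow> p \<notin> path_image (C R) \<and> winding_number (C R) p = winding_number (C R) pR"
proof -
  define \<theta> where "\<theta> = ccw_angle w F E"
  have \<theta>: "0 < \<theta>" "\<theta> < 2 * pi" using ang ccw_angle_bounds unfolding \<theta>_def by auto
  have Fw: "F \<noteq> w" and Ew: "E \<noteq> w" using F E \<rho> by auto
  have Eeq: "E = w + (F - w) * cis \<theta>"
    unfolding \<theta>_def using F E Fw by (intro ccw_angle_cis) auto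
  let ?L = "sector w (F - w) 0 \<theta>" and ?R = "sector w (F - w) \<theta> (2 * pi)"
  have disj: "p \<notin> path_image (C R)" if "p \<in> ?L \<union> ?R" for p
  proof -
    from that obtain s \<phi> where s: "0 < s" "s \<le> 1" "0 < \<phi>" "\<phi> < 2 * pi" "\<phi> \<noteq> \<theta>"
      and p: "p = w + of_real s * (F - w) * cis \<phi>"
    proof (cases "p \<in> ?L")
      case True
      then show ?thesis by (rule sectorE) (use \<theta> that in auto)
    next
      case False
      with \<open>p \<in> ?L \<union> ?R\<close> have "p \<in> ?R" by blast
      then show ?thesis by (rule sectorE) (use \<theta> that[OF _ _ less_trans[OF \<theta>(1)]] in auto)
    qed
    have nF: "p \<noteq> w + of_real t * (F - w)" if "0 \<le> t" for t
    proof
      assume "p = w + of_real t * (F - w)"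
      then have "of_real s * cis \<phi> = of_real t * cis 0" using Fw by (simp add: p)
      then have "\<phi> = 0" using cis_eq_real_multiple[of s \<phi> t 0] s that by simp
      then show False using s by simp
    qed
    have nE: "p \<noteq> w + of_real t * (E - w)" if "0 \<le> t" for t
    proof
      assume "p = w + of_real t * (E - w)"
      then have "of_real s * cis \<phi> = of_real t * cis \<theta>" using Fw by (simp add: p Eeq)
      then have "\<phi> = \<theta>" using cis_eq_real_multiple[of s \<phi> t \<theta>] s that \<theta> by simp
      then show False using s by simp
    qed
    have "p \<notin> closed_segment w F"
    proof
      assume "p \<in> closed_segment w F"
      then obtain t where "0 \<le> t" "p = (1 - t) *\<^sub>R w + t *\<^sub>R F" by (auto simp: in_segment)
      then show False using nF[of t] by (simp add: scaleR_conv_of_real algebra_simps)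
    qed
    moreover have "p \<notin> closed_segment w E"
    proof
      assume "p \<in> closed_segment w E"
      then obtain t where "0 \<le> t" "p = (1 - t) *\<^sub>R w + t *\<^sub>R E" by (auto simp: in_segment)
      then show False using nE[of t] by (simp add: scaleR_conv_of_real algebra_simps)
    qed
    moreover have "p \<notin> path_image R"
    proof
      assume "p \<in> path_image R"
      moreover have "p \<in> cball w \<rho>"
        using s F \<rho> mult_left_le_one_le[of "cmod (F - w)" s] by (simp add: p dist_norm norm_mult)
      ultimately have "p = E \<or> p = F" using R by blast
      then show False using nF[of 1] nE[of 1] by auto
    qed
    ultimately show ?thesis
      unfolding C_def using R by (simp add: path_image_join closed_segment_commute)
  qed
  have C: "path (C R)" "pathfinish (C R) = pathstart (C R)" unfolding C_def using R by auto
  have const: "winding_number (C R) p = winding_number (C R) q"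
    if "p \<in> S" "q \<in> S" "S = ?L \<or> S = ?R" for p q S
    using C that(1,2)
  proof (rule winding_number_eq)
    show "Topological_Spaces.connected S" using that(3) connected_sector by blast
    show "S \<inter> path_image (C R) = {}" using that(3) disj by blast
  qed
  \<comment> \<open>The unit vector bisecting the angle from \<open>F\<close> to \<open>E\<close>;
    in its frame \<open>F\<close> and \<open>E\<close> have polar angles -theta/2 and
    theta/2.\<close>
  define u where "u = (F - w) / of_real \<rho> * cis (\<theta> / 2)"
  define x where "x = \<rho> * cos (\<theta> / 2)"
  define y where "y = \<rho> * sin (\<theta> / 2)"
  have u: "cmod u = 1" unfolding u_def using F \<rho> by (simp add: norm_mult norm_divide)
  have xy: "x\<^sup>2 + y\<^sup>2 = \<rho>\<^sup>2"
    unfolding x_def y_def by (simp add: power_mult_distrib distrib_left[symmetric])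
  have ypos: "y > 0" unfolding y_def using \<rho> \<theta> by (simp add: sin_gt_zero)
  have Cx: "Complex x (- y) = of_real \<rho> * cis (- (\<theta> / 2))" "Complex x y = of_real \<rho> * cis (\<theta> / 2)"
    unfolding x_def y_def by (simp_all add: complex_eq_iff)
  have F': "F = w + u * Complex x (- y)" unfolding Cx u_def using \<rho> by (simp add: cis_mult)
  have E': "E = w + u * Complex x y" unfolding Cx u_def Eeq using \<rho> by (simp add: cis_mult mult.assoc)
  define pL where "pL = w + (w + u * Complex x (-y) - w) / 4 + (w + u * of_real \<rho> - w) / 4"
  define pR where "pR = w - u * of_real (\<rho> / 2)"
  have jump: "winding_number (C R) pL = winding_number (C R) pR + 1"
    unfolding C_def pL_def pR_def F' E'
    by (rule wedge_jump[OF u \<rho> ypos xy]) (use R \<rho> F E F' E' in \<open>auto simp: dist_norm norm_minus_commute\<close>)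
  have pL: "pL \<in> ?L"
  proof -
    have cc: "cos (\<theta> / 4) > 0" using \<theta> by (intro cos_gt_zero) auto
    \<comment> \<open>The half-angle formula brings \<open>pL\<close> into polar form relative to
      \<open>F - w\<close>: angle theta/4, scale cos(theta/4)/2.\<close>
    have "1 + cis (\<theta> / 2) = 2 * of_real (cos (\<theta> / 4)) * cis (\<theta> / 4)"
      using cos_double_cos[of "\<theta> / 4"] sin_double[of "\<theta> / 4"]
      by (simp add: complex_eq_iff power2_eq_square)
    moreover have "pL = w + (F - w) * (1 + cis (\<theta> / 2)) / 4"
    proof -
      have "u * of_real \<rho> = (F - w) * cis (\<theta> / 2)" unfolding u_def using \<rho> by simp
      then have "pL = w + (F - w) / 4 + (F - w) * cis (\<theta> / 2) / 4"
        unfolding pL_def F'[symmetric] by simp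
      then show ?thesis by (simp add: distrib_left add_divide_distrib)
    qed
    moreover have "z * (2 * a * c) / 4 = a / 2 * z * c" for z a c :: complex by simp
    ultimately have "pL = w + of_real (cos (\<theta> / 4) / 2) * (F - w) * cis (\<theta> / 4)"
      by (simp only: of_real_divide of_real_numeral)
    moreover have "cos (\<theta> / 4) / 2 \<le> 1" using cos_le_one[of "\<theta> / 4"] by linarith
    ultimately show ?thesis
      using sectorI[of "cos (\<theta> / 4) / 2" 0 "\<theta> / 4" \<theta> w "F - w"] cc \<theta> by simp
  qed
  have pR: "pR \<in> ?R"
  proof -
    \<comment> \<open>\<open>pR\<close> has angle theta/2 + pi, which lies strictly between theta
      and 2 pi because theta < 2 pi.\<close>
    have "cis (\<theta> / 2 + pi) = - cis (\<theta> / 2)" by (simp add: complex_eq_iff)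
    then have "pR = w + of_real (1 / 2) * (F - w) * cis (\<theta> / 2 + pi)"
      unfolding pR_def u_def using \<rho> by (simp add: field_simps)
    then show ?thesis using \<theta> by (auto intro!: sectorI simp del: of_real_divide)
  qed
  have inL: "p \<in> ?L" if "cmod (p - w) = \<rho>" "0 < ccw_angle w F p" "ccw_angle w F p < \<theta>" for p
  proof -
    have "p = w + of_real 1 * (F - w) * cis (ccw_angle w F p)"
      using ccw_angle_cis[of F w p] that F Fw by simp
    moreover have "\<dots> \<in> ?L" using that by (intro sectorI) auto
    ultimately show ?thesis by simp
  qed
  have inR: "p \<in> ?R" if "cmod (p - w) = \<rho>" "\<theta> < ccw_angle w F p" for p
  proof -
    have "p = w + of_real 1 * (F - w) * cis (ccw_angle w F p)"
      using ccw_angle_cis[of F w p] that F Fw by simp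
    moreover have "\<dots> \<in> ?R" using that ccw_angle_bounds by (intro sectorI) auto
    ultimately show ?thesis by simp
  qed
  show thesis
  proof (rule that[of pL pR])
    show "p \<notin> path_image (C R) \<and> winding_number (C R) p = winding_number (C R) pL"
      if "cmod (p - w) = \<rho>" "0 < ccw_angle w F p" "ccw_angle w F p < ccw_angle w F E" for p
      using inL[of p] that disj const[of p ?L pL] pL unfolding \<theta>_def by blast
    show "p \<notin> path_image (C R) \<and> winding_number (C R) p = winding_number (C R) pR"
      if "cmod (p - w) = \<rho>" "ccw_angle w F E < ccw_angle w F p" for p
      using inR[of p] that disj const[of p ?R pR] pR unfolding \<theta>_def by blast
  qed (use pL pR disj jump in blast)+
qed

section \<open>The two sides of a simple loop at a point\<close>

text \<open>The supremum inside \<open>exit_point\<close>, stated for an arbitrary curve so that it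
  also applies to reparametrised pieces of a loop.\<close>

definition exit_time :: "complex \<Rightarrow> (real \<Rightarrow> complex) \<Rightarrow> real \<Rightarrow> real" where
  "exit_time w h \<rho> = Sup {t \<in> {0..1}. dist w (h t) \<le> \<rho>}"

lemma exit_time_mem:
  assumes h: "continuous_on {0..1} h" "h 0 = w" and \<rho>: "0 \<le> \<rho>"
  shows "exit_time w h \<rho> \<in> {0..1}" "dist w (h (exit_time w h \<rho>)) \<le> \<rho>"
    "\<And>t. t \<in> {exit_time w h \<rho><..1} \<Longrightarrow> \<rho> < dist w (h t)"
proof -
  let ?S = "{t \<in> {0..1}. dist w (h t) \<le> \<rho>}"
  have "closed ?S"
    using h(1) by (intro continuous_on_closed_Collect_le continuous_intros) auto
  moreover have "0 \<in> ?S" using h \<rho> by simp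
  then have "?S \<noteq> {}" by blast
  moreover have bdd: "bdd_above ?S" by (rule bdd_aboveI[of _ 1]) auto
  ultimately have "exit_time w h \<rho> \<in> ?S"
    unfolding exit_time_def by (intro closed_contains_Sup)
  then show mem: "exit_time w h \<rho> \<in> {0..1}" "dist w (h (exit_time w h \<rho>)) \<le> \<rho>" by auto
  show "\<rho> < dist w (h t)" if "t \<in> {exit_time w h \<rho><..1}" for t
  proof (rule ccontr)
    assume "\<not> \<rho> < dist w (h t)"
    with that mem have "t \<in> ?S" by auto
    then have "t \<le> exit_time w h \<rho>" unfolding exit_time_def using bdd by (rule cSup_upper)
    with that show False by simp
  qed
qed

text \<open>The curve ends outside the disc, so it meets the circle at or after its last time in the
  disc, and no later meeting is possible.\<close>

lemma exit_time_dist: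
  assumes h: "continuous_on {0..1} h" "h 0 = w" and \<rho>: "0 \<le> \<rho>" "\<rho> < dist w (h 1)"
  shows "dist w (h (exit_time w h \<rho>)) = \<rho>" "exit_time w h \<rho> < 1"
proof -
  note mem = exit_time_mem[OF h \<rho>(1)]
  let ?T = "exit_time w h \<rho>"
  have "continuous_on {?T..1} (\<lambda>t. dist w (h t))"
    using h(1) mem(1) by (intro continuous_intros) (auto elim: continuous_on_subset)
  then obtain t where t: "?T \<le> t" "t \<le> 1" "dist w (h t) = \<rho>"
    using IVT'[of "\<lambda>t. dist w (h t)" ?T \<rho> 1] mem \<rho> by auto
  with mem(3)[of t] have "t = ?T" by (cases "t = ?T") auto
  with t show "dist w (h ?T) = \<rho>" by simp
  with \<rho> have "?T \<noteq> 1" by auto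
  with mem(1) show "?T < 1" by simp
qed

text \<open>On the compact interval from \<open>\<delta>\<close> to 1 the curve keeps a positive
  distance from \<open>w\<close>, so a smaller disc has been left for good before time
  \<open>\<delta>\<close>.\<close>

lemma exit_time_tendsto_0:
  assumes h: "continuous_on {0..1} h" "h 0 = w" "\<And>t. t \<in> {0<..1} \<Longrightarrow> h t \<noteq> w" and "0 < \<delta>"
  shows "eventually (\<lambda>\<rho>. exit_time w h \<rho> < \<delta>) (at_right 0)"
proof (cases "\<delta> \<le> 1")
  case True
  have "continuous_on {\<delta>..1} h" by (rule continuous_on_subset[OF h(1)]) (use \<open>0 < \<delta>\<close> in auto)
  then have "continuous_on {\<delta>..1} (\<lambda>t. dist w (h t))" by (intro continuous_intros)
  then obtain t0 where t0: "t0 \<in> {\<delta>..1}" and min: "\<forall>t\<in>{\<delta>..1}. dist w (h t0) \<le> dist w (h t)"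
    using continuous_attains_inf[of "{\<delta>..1}" "\<lambda>t. dist w (h t)"] True by auto
  define m where "m = dist w (h t0)"
  have m: "m \<le> dist w (h t)" if "t \<in> {\<delta>..1}" for t using min that unfolding m_def by blast
  have "m > 0" using h(3)[of t0] t0 \<open>0 < \<delta>\<close> unfolding m_def by auto
  then have "eventually (\<lambda>\<rho>. \<rho> \<in> {0<..<m}) (at_right 0)" by (rule eventually_at_right_real)
  then show ?thesis
  proof eventually_elim
    case (elim \<rho>)
    then have "0 \<le> \<rho>" by simp
    note mem = exit_time_mem(1,2)[OF h(1,2) this]
    show ?case
    proof (rule ccontr)
      assume "\<not> ?thesis"
      then have "m \<le> dist w (h (exit_time w h \<rho>))" using mem by (intro m) auto
      with mem elim show False by auto
    qed
  qed
next
  case False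
  have "eventually (\<lambda>\<rho>::real. 0 < \<rho>) (at_right 0)" by (rule eventually_at_right_less)
  then show ?thesis
  proof eventually_elim
    case (elim \<rho>)
    then have "0 \<le> \<rho>" by simp
    from exit_time_mem(1)[OF h(1,2) this] False show ?case by simp
  qed
qed

text \<open>A point with nonzero winding number must be inside, and it fixes the orientation: the
  winding number is constant inside a simple loop and 0 outside.\<close>

lemma simple_loop_winding_number_values:
  assumes "simple_path c" "pathfinish c = pathstart c" "winding_number c z = s" "s \<noteq> 0" "z \<notin> path_image c"
    and "p \<notin> path_image c"
  shows "winding_number c p \<in> {0, s}"
proof -
  have out: "winding_number c q = 0" if "q \<in> outside (path_image c)" for q
    using that assms by (intro winding_number_zero_in_outside) (auto simp: simple_path_imp_path)
  have io: "q \<in> inside (path_image c) \<or> q \<in> outside (path_image c)" if "q \<notin> path_image c" for q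
    using that inside_Un_outside[of "path_image c"] by blast
  have "z \<in> inside (path_image c)" using io[of z] out[of z] assms by blast
  with assms(3) have "winding_number c q = s" if "q \<in> inside (path_image c)" for q
    using simple_closed_path_winding_number_inside[OF assms(1)] that by metis
  with io[of p] out[of p] assms show ?thesis by blast
qed

lemma wedge_simple:
  fixes w F E :: complex and \<rho> :: real
  assumes \<rho>: "\<rho> > 0" and F: "cmod (F - w) = \<rho>" and E: "cmod (E - w) = \<rho>" and "E \<noteq> F"
    and R: "arc R" "pathstart R = F" "pathfinish R = E" "path_image R \<inter> cball w \<rho> \<subseteq> {E, F}"
  shows "simple_path (linepath w F +++ R +++ linepath E w)"
proof -
  have ne: "F \<noteq> w" "E \<noteq> w" using F E \<rho> by auto
  have seg: "\<exists>t. 0 \<le> t \<and> t \<le> 1 \<and> z = w + of_real t * (p - w)" if "z \<in> closed_segment w p" for z p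
  proof -
    from that obtain t where "0 \<le> t" "t \<le> 1" "z = (1 - t) *\<^sub>R w + t *\<^sub>R p" by (auto simp: in_segment)
    then show ?thesis by (intro exI[of _ t]) (simp add: scaleR_conv_of_real algebra_simps)
  qed
  have inter: "z = w" if z: "z \<in> closed_segment w F" "z \<in> closed_segment w E" for z
  proof -
    from seg[OF z(1)] obtain t where t: "0 \<le> t" "z = w + of_real t * (F - w)" by blast
    from seg[OF z(2)] obtain t' where t': "0 \<le> t'" "z = w + of_real t' * (E - w)" by blast
    have eq: "of_real t * (F - w) = of_real t' * (E - w)" using t(2) t'(2) by simp
    then have "cmod (of_real t * (F - w)) = cmod (of_real t' * (E - w))" by simp
    then have "t * \<rho> = t' * \<rho>" using t(1) t'(1) F E by (simp add: norm_mult)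
    then have "t = t'" using \<rho> by simp
    with eq \<open>E \<noteq> F\<close> have "t = 0" by auto
    with t show ?thesis by simp
  qed
  have sub: "closed_segment w F \<subseteq> cball w \<rho>" "closed_segment w E \<subseteq> cball w \<rho>"
    using \<rho> F E by (simp_all add: closed_segment_subset dist_norm norm_minus_commute)
  have "E \<notin> closed_segment w F" "F \<notin> closed_segment w E"
    using inter[of E] inter[of F] ne by auto
  with sub R have "path_image R \<inter> closed_segment w F \<subseteq> {F}" "path_image R \<inter> closed_segment w E \<subseteq> {E}"
    by blast+
  with inter ne R show ?thesis
    by (intro simple_path_join3I) (auto simp: closed_segment_commute[of E w])
qed

text \<open>The piece of the path followed by its reversed chord is a closed path in the ball. The
  ball is convex, so the winding number about a point outside it vanishes.\<close>

lemma winding_number_replace_by_segment: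
  assumes "path c" "u \<in> {0..1}" "v \<in> {0..1}" "c ` closed_segment u v \<subseteq> ball w \<eta>" "z \<notin> ball w \<eta>"
  shows "winding_number (subpath u v c) z = winding_number (linepath (c u) (c v)) z"
    "z \<notin> path_image (subpath u v c)" "z \<notin> closed_segment (c u) (c v)"
proof -
  have im: "path_image (subpath u v c) \<subseteq> ball w \<eta>" using assms by (simp add: path_image_subpath_gen)
  then show z1: "z \<notin> path_image (subpath u v c)" using assms by blast
  have ends: "c u \<in> ball w \<eta>" "c v \<in> ball w \<eta>" using assms by auto
  then have seg: "closed_segment (c u) (c v) \<subseteq> ball w \<eta>" by (simp add: closed_segment_subset)
  then show z2: "z \<notin> closed_segment (c u) (c v)" using assms by blast
  have p: "path (subpath u v c)" using assms by (simp add: path_subpath)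
  have "winding_number (subpath u v c +++ linepath (c v) (c u)) z = 0"
    by (rule winding_number_zero_outside[of _ "ball w \<eta>"])
      (use p im seg assms in \<open>auto simp: path_image_join closed_segment_commute\<close>)
  moreover have "winding_number (linepath (c v) (c u)) z = - winding_number (linepath (c u) (c v)) z"
    using winding_number_reversepath[of "linepath (c u) (c v)" z] z2 by simp
  ultimately show "winding_number (subpath u v c) z = winding_number (linepath (c u) (c v)) z"
    using p z1 z2 by (simp add: winding_number_join closed_segment_commute)
qed

text \<open>
  \<open>hF\<close> and \<open>hE\<close> are the loop leaving \<open>w\<close> and, reversed, the loop arriving at \<open>w\<close>. The curve \<open>h\<close> starts
  on the left of the loop in the first case and on the right in the second one.
\<close>

lemma simple_loop_sides:
  fixes c h :: "real \<Rightarrow> complex" and w z0 :: complex and a b :: real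
  defines "hF \<equiv> \<lambda>t. c (a * t / 2)" and "hE \<equiv> \<lambda>t. c (1 - b * t / 2)"
  defines "X \<equiv> \<lambda>k \<rho>. k (exit_time w k \<rho>)"
  assumes c: "simple_path c" "pathstart c = w" "pathfinish c = w"
    and ab: "0 < a" "a \<le> 1" "0 < b" "b \<le> 1"
    and h: "continuous_on {0..1} h" "h 0 = w" and hc: "h ` {0<..1} \<inter> path_image c = {}"
    and z0: "z0 \<in> inside (path_image c)"
  shows "eventually (\<lambda>\<rho>. 0 < ccw_angle w (X hF \<rho>) (X h \<rho>) \<and>
        ccw_angle w (X hF \<rho>) (X h \<rho>) < ccw_angle w (X hF \<rho>) (X hE \<rho>) \<longrightarrow>
        winding_number c (h 1) = (if winding_number c z0 = 1 then 1 else 0)) (at_right 0)"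
    and "eventually (\<lambda>\<rho>. 0 < ccw_angle w (X hE \<rho>) (X h \<rho>) \<and>
        ccw_angle w (X hE \<rho>) (X h \<rho>) < ccw_angle w (X hE \<rho>) (X hF \<rho>) \<longrightarrow>
        winding_number c (h 1) = (if winding_number c z0 = 1 then 0 else -1)) (at_right 0)"
proof -
  have h3: "h t \<notin> path_image c" if "t \<in> {0<..1}" for t using hc that by blast
  have pc: "path c" and cont: "continuous_on {0..1} c" using c by (auto simp: simple_path_def path_def)
  have c01: "c 0 = w" "c 1 = w" using c by (auto simp: pathstart_def pathfinish_def)
  have cw: "c t \<noteq> w" if "0 < t" "t < 1" for t
    using c(1) that c01 unfolding simple_path_def loop_free_def
    by (metis atLeastAtMost_iff less_eq_real_def less_irrefl zero_less_one)
  have ab2: "0 \<le> a * t" "a * t \<le> 1" "0 \<le> b * t" "b * t \<le> 1" if "t \<in> {0..1}" for t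
    using ab that by (auto simp: mult_le_one)
  have hFc: "continuous_on {0..1} hF" unfolding hF_def
    by (intro continuous_on_compose2[OF cont] continuous_intros) (use ab2 in fastforce)+
  have hEc: "continuous_on {0..1} hE" unfolding hE_def
    by (intro continuous_on_compose2[OF cont] continuous_intros) (use ab2 in fastforce)+
  have hF0: "hF 0 = w" and hE0: "hE 0 = w" unfolding hF_def hE_def using c01 by auto
  have hFw: "hF t \<noteq> w" if "t \<in> {0<..1}" for t
    unfolding hF_def using ab2[of t] that ab by (intro cw) auto
  have hEw: "hE t \<noteq> w" if "t \<in> {0<..1}" for t
    unfolding hE_def using ab2[of t] that ab by (intro cw) auto
  have winc: "w \<in> path_image c" using c by (metis pathstart_in_path_image)
  have z0c: "z0 \<notin> path_image c" using z0 inside_no_overlap by blast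
  have h1: "h 1 \<notin> path_image c" using h3 by simp
  have s0: "winding_number c z0 = 1 \<or> winding_number c z0 = -1"
    by (rule simple_closed_path_winding_number_inside[OF c(1)]) (use z0 in auto)
  \<comment> \<open>Winding numbers are compared at \<open>z0\<close> and at \<open>h 1\<close>;
    changes of the loop inside this ball do not affect them.\<close>
  define \<eta> where "\<eta> = min (dist w z0) (dist w (h 1))"
  have \<eta>: "\<eta> > 0" unfolding \<eta>_def using z0c h1 winc by auto
  have out\<eta>: "z0 \<notin> ball w \<eta>" "h 1 \<notin> ball w \<eta>" unfolding \<eta>_def by auto
  obtain \<delta>0 where \<delta>0: "\<delta>0 > 0" "\<And>t. t \<in> {0..1} \<Longrightarrow> dist t 0 < \<delta>0 \<Longrightarrow> dist (c t) (c 0) < \<eta>"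
    using cont \<eta> unfolding continuous_on_iff by (meson atLeastAtMost_iff order_refl zero_le_one)
  obtain \<delta>1 where \<delta>1: "\<delta>1 > 0" "\<And>t. t \<in> {0..1} \<Longrightarrow> dist t 1 < \<delta>1 \<Longrightarrow> dist (c t) (c 1) < \<eta>"
    using cont \<eta> unfolding continuous_on_iff by (meson atLeastAtMost_iff order_refl zero_le_one)
  \<comment> \<open>\<open>hF\<close> and \<open>hE\<close> cover the two ends of the loop. The part
    in between stays away from \<open>w\<close> by some positive distance, so small discs meet only
    the ends.\<close>
  have "continuous_on {a/2..1 - b/2} c" by (rule continuous_on_subset[OF cont]) (use ab in auto)
  then have "continuous_on {a/2..1 - b/2} (\<lambda>t. dist w (c t))" by (intro continuous_intros)
  then obtain t0 where t0: "t0 \<in> {a/2..1 - b/2}"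
      and min: "\<forall>t\<in>{a/2..1 - b/2}. dist w (c t0) \<le> dist w (c t)"
    using continuous_attains_inf[of "{a/2..1 - b/2}" "\<lambda>t. dist w (c t)"] ab by auto
  define \<mu> where "\<mu> = dist w (c t0)"
  have \<mu>: "\<mu> \<le> dist w (c t)" if "t \<in> {a/2..1 - b/2}" for t using min that unfolding \<mu>_def by blast
  have \<mu>0: "\<mu> > 0" using cw[of t0] t0 ab unfolding \<mu>_def by auto
  define m where "m = Min {\<mu>, \<eta>, dist w (hF 1), dist w (hE 1)}"
  have "m > 0" unfolding m_def using \<mu>0 \<eta> hFw[of 1] hEw[of 1] by auto
  have main: "(0 < ccw_angle w (X hF \<rho>) (X h \<rho>) \<and>
        ccw_angle w (X hF \<rho>) (X h \<rho>) < ccw_angle w (X hF \<rho>) (X hE \<rho>) \<longrightarrow>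
        winding_number c (h 1) = (if winding_number c z0 = 1 then 1 else 0)) \<and>
      (0 < ccw_angle w (X hE \<rho>) (X h \<rho>) \<and>
        ccw_angle w (X hE \<rho>) (X h \<rho>) < ccw_angle w (X hE \<rho>) (X hF \<rho>) \<longrightarrow>
        winding_number c (h 1) = (if winding_number c z0 = 1 then 0 else -1))"
    if \<rho>: "0 < \<rho>" "\<rho> < m" and TF\<delta>: "exit_time w hF \<rho> < \<delta>0" and TE\<delta>: "exit_time w hE \<rho> < \<delta>1" for \<rho>
  proof -
    have \<rho>': "\<rho> < \<mu>" "\<rho> < \<eta>" "\<rho> < dist w (hF 1)" "\<rho> < dist w (hE 1)" "\<rho> < dist w (h 1)" "0 \<le> \<rho>"
      using \<rho> unfolding m_def \<eta>_def by auto
    define TF where "TF = exit_time w hF \<rho>"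
    define TE where "TE = exit_time w hE \<rho>"
    define TA where "TA = exit_time w h \<rho>"
    note memF = exit_time_mem[OF hFc hF0 \<rho>'(6), folded TF_def]
    note memE = exit_time_mem[OF hEc hE0 \<rho>'(6), folded TE_def]
    note memA = exit_time_mem[OF h(1,2) \<rho>'(6), folded TA_def]
    note dF = exit_time_dist[OF hFc hF0 \<rho>'(6,3), folded TF_def]
    note dE = exit_time_dist[OF hEc hE0 \<rho>'(6,4), folded TE_def]
    note dA = exit_time_dist[OF h(1,2) \<rho>'(6,5), folded TA_def]
    have T0: "0 < TF" "0 < TE" "0 < TA"
      using dF dE dA memF(1) memE(1) memA(1) \<rho>(1) hF0 hE0 h(2) by (auto simp: less_le)
    define F where "F = X hF \<rho>"
    define E where "E = X hE \<rho>"
    define A where "A = X h \<rho>"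
    define \<tau>F where "\<tau>F = a * TF / 2"
    define \<tau>E where "\<tau>E = 1 - b * TE / 2"
    have FEA: "F = c \<tau>F" "E = c \<tau>E" "A = h TA"
      unfolding F_def E_def A_def \<tau>F_def \<tau>E_def X_def TF_def TE_def TA_def hF_def hE_def by auto
    have norms: "cmod (F - w) = \<rho>" "cmod (E - w) = \<rho>" "cmod (A - w) = \<rho>"
      unfolding FEA using dF dE dA by (auto simp: \<tau>F_def \<tau>E_def hF_def hE_def dist_norm norm_minus_commute)
    have aT': "a * TF \<le> TF" "b * TE \<le> TE"
      using ab T0 by (simp_all add: mult_left_le_one_le)
    have aT: "0 < a * TF" "a * TF < a" "0 < b * TE" "b * TE < b" using ab T0 dF dE by auto
    have \<tau>: "0 < \<tau>F" "\<tau>F < a / 2" "1 - b / 2 < \<tau>E" "\<tau>E < 1" "\<tau>F < \<tau>E" "\<tau>F \<in> {0..1}" "\<tau>E \<in> {0..1}"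
    proof -
      have "a * TF < 1" "b * TE < 1" using aT ab by linarith+
      then show "0 < \<tau>F" "\<tau>F < a / 2" "1 - b / 2 < \<tau>E" "\<tau>E < 1" "\<tau>F < \<tau>E" "\<tau>F \<in> {0..1}" "\<tau>E \<in> {0..1}"
        unfolding \<tau>F_def \<tau>E_def using aT by auto
    qed
    \<comment> \<open>The loop between the two last exits. It meets the closed disc only at its
      endpoints, however often \<open>c\<close> crosses the circle before \<open>\<tau>F\<close> and
      after \<open>\<tau>E\<close>.\<close>
    define R where "R = subpath \<tau>F \<tau>E c"
    have arcR: "arc R" unfolding R_def using c(1) \<tau> by (intro arc_simple_path_subpath_interior) auto
    have Rends: "pathstart R = F" "pathfinish R = E" unfolding R_def FEA by auto
    have Rc: "path_image R \<subseteq> path_image c" unfolding R_def using \<tau> by (intro path_image_subpath_subset)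
    have Rball: "path_image R \<inter> cball w \<rho> \<subseteq> {E, F}"
    proof
      fix z assume z: "z \<in> path_image R \<inter> cball w \<rho>"
      then obtain t where t: "\<tau>F \<le> t" "t \<le> \<tau>E" "z = c t" "dist w (c t) \<le> \<rho>"
        unfolding R_def using \<tau> by (auto simp: path_image_subpath)
      consider "t = \<tau>F" | "t = \<tau>E" | "\<tau>F < t" "t \<le> a / 2" | "a / 2 \<le> t" "t \<le> 1 - b / 2" | "1 - b / 2 \<le> t" "t < \<tau>E"
        using t by linarith
      then show "z \<in> {E, F}"
      proof cases
        case 3
        define T where "T = 2 * t / a"
        have "TF < T" "T \<le> 1" using 3 ab by (auto simp: T_def \<tau>F_def field_simps)
        then have "\<rho> < dist w (hF T)" by (intro memF(3)) auto
        then show ?thesis using t(4) ab by (simp add: hF_def T_def)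
      next
        case 4
        then show ?thesis using \<mu>[of t] t(4) \<rho>' by auto
      next
        case 5
        define T where "T = 2 * (1 - t) / b"
        have "TE < T" "T \<le> 1" using 5 ab by (auto simp: T_def \<tau>E_def field_simps)
        then have "\<rho> < dist w (hE T)" by (intro memE(3)) auto
        moreover have "1 - b * T / 2 = t" using ab by (simp add: T_def field_simps)
        ultimately show ?thesis using t(4) by (simp add: hE_def)
      qed (use t FEA in auto)
    qed
    \<comment> \<open>This loop differs from \<open>c\<close> only within \<open>ball w \<eta>\<close>, which contains neither \<open>z0\<close> nor \<open>h 1\<close>.\<close>
    define C where "C = linepath w F +++ R +++ linepath E w"
    have pR: "path R" using arcR by (rule arc_imp_path)
    have pC: "path C" "pathfinish C = pathstart C" unfolding C_def using pR Rends by auto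
    have Cim: "path_image C \<subseteq> cball w \<rho> \<union> path_image c"
    proof -
      have "closed_segment w F \<subseteq> cball w \<rho>" "closed_segment w E \<subseteq> cball w \<rho>"
        using \<rho>(1) norms by (simp_all add: closed_segment_subset dist_norm norm_minus_commute)
      then show ?thesis unfolding C_def using Rc Rends
        by (auto simp: path_image_join closed_segment_commute[of E w])
    qed
    have same: "winding_number C z = winding_number c z" if z: "z \<notin> ball w \<eta>" "z \<notin> path_image c" for z
    proof -
      have init: "c ` closed_segment 0 \<tau>F \<subseteq> ball w \<eta>"
      proof (clarify, goal_cases)
        case (1 z t)
        then have "t \<in> {0..1}" "t \<le> \<tau>F" using \<tau> by (auto simp: closed_segment_eq_real_ivl)
        moreover have "\<tau>F < \<delta>0" using TF\<delta> T0 aT' unfolding \<tau>F_def TF_def[symmetric] by linarith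
        ultimately show ?case using \<delta>0(2)[of t] c01 by (auto simp: dist_commute)
      qed
      have fin: "c ` closed_segment \<tau>E 1 \<subseteq> ball w \<eta>"
      proof (clarify, goal_cases)
        case (1 z t)
        then have "t \<in> {0..1}" "\<tau>E \<le> t" using \<tau> by (auto simp: closed_segment_eq_real_ivl)
        moreover have "1 - \<tau>E < \<delta>1" using TE\<delta> T0 aT' unfolding \<tau>E_def TE_def[symmetric] by linarith
        ultimately show ?case using \<delta>1(2)[of t] c01 by (auto simp: dist_commute dist_real_def)
      qed
      note wi = winding_number_replace_by_segment[OF pc _ \<tau>(6) init z(1), unfolded c01 FEA(1)[symmetric]]
      note wf = winding_number_replace_by_segment[OF pc \<tau>(7) _ fin z(1), unfolded c01 FEA(2)[symmetric]]
      have zR: "z \<notin> path_image R" using Rc z by blast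
      have "winding_number C z = winding_number (linepath w F) z + winding_number R z + winding_number (linepath E w) z"
        unfolding C_def using wi wf pR Rends zR by (simp add: winding_number_join path_image_join)
      also have "\<dots> = winding_number (subpath 0 \<tau>F c) z + winding_number (subpath \<tau>F \<tau>E c) z + winding_number (subpath \<tau>E 1 c) z"
        using wi wf unfolding R_def by simp
      also have "\<dots> = winding_number (subpath 0 1 c) z"
        using winding_number_subpath_combine[OF pc z(2), of 0 \<tau>F \<tau>E] winding_number_subpath_combine[OF pc z(2), of 0 \<tau>E 1] \<tau>
        by simp
      finally show ?thesis by simp
    qed
    \<comment> \<open>After its last exit \<open>h\<close> stays outside the disc and off
      \<open>c\<close>, hence off \<open>C\<close>, so the winding number at \<open>h 1\<close> can
      be read off at the exit point \<open>A\<close>.\<close>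
    have wA: "winding_number c (h 1) = winding_number C A" if "A \<notin> path_image C"
    proof -
      have "winding_number C (h 1) = winding_number C A"
      proof (rule winding_number_eq[OF pC])
        show "Topological_Spaces.connected (h ` {TA..1})"
          using h(1) T0 by (intro connected_continuous_image) (auto elim: continuous_on_subset)
        show "h ` {TA..1} \<inter> path_image C = {}"
        proof (rule equals0I)
          fix y assume y: "y \<in> h ` {TA..1} \<inter> path_image C"
          then obtain t where t: "TA \<le> t" "t \<le> 1" "y = h t" by auto
          show False
          proof (cases "t = TA")
            case True
            then show ?thesis using y t that FEA by simp
          next
            case False
            then have "\<rho> < dist w (h t)" using memA(3)[of t] t by simp
            moreover have "h t \<notin> path_image c" using h3[of t] t T0 by simp
            ultimately show ?thesis using y t Cim by auto
          qed
        qed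
      qed (use FEA dA in auto)
      then show ?thesis using same[OF out\<eta>(2) h1] by simp
    qed
    have sides: "(ccw_angle w F A < ccw_angle w F E \<and> 0 < ccw_angle w F A \<longrightarrow>
        winding_number c (h 1) = (if winding_number c z0 = 1 then 1 else 0)) \<and>
       (ccw_angle w F E < ccw_angle w F A \<longrightarrow>
        winding_number c (h 1) = (if winding_number c z0 = 1 then 0 else -1))" if ang: "0 < ccw_angle w F E"
    proof -
      have "E \<noteq> F" using ang \<rho>(1) norms ccw_angle_eqI[of F w F 0] by auto
      have sC: "simple_path C"
        unfolding C_def by (rule wedge_simple[OF \<rho>(1) norms(1,2) \<open>E \<noteq> F\<close> arcR Rends Rball])
      have z0C: "winding_number C z0 = winding_number c z0" by (rule same[OF out\<eta>(1) z0c])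
      have "z0 \<notin> path_image C" using Cim z0c out\<eta>(1) \<rho>'(2) by auto
      then have vals: "winding_number C p \<in> {0, winding_number c z0}" if "p \<notin> path_image C" for p
        using simple_loop_winding_number_values[OF sC pC(2) z0C _ _ that] s0 by auto
      from wedge_sides[OF \<rho>(1) norms(1,2) ang pR Rends Rball, folded C_def] obtain pL pR where p:
        "pL \<notin> path_image C" "pR \<notin> path_image C" "winding_number C pL = winding_number C pR + 1"
        "\<And>p. \<lbrakk>cmod (p - w) = \<rho>; 0 < ccw_angle w F p; ccw_angle w F p < ccw_angle w F E\<rbrakk>
           \<Longrightarrow> p \<notin> path_image C \<and> winding_number C p = winding_number C pL"
        "\<And>p. \<lbrakk>cmod (p - w) = \<rho>; ccw_angle w F E < ccw_angle w F p\<rbrakk>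
           \<Longrightarrow> p \<notin> path_image C \<and> winding_number C p = winding_number C pR"
        by blast
      \<comment> \<open>The available values are 0 and 1, or -1 and 0, according to the orientation;
        the jump by one leaves a single assignment to the two sides.\<close>
      have "winding_number C pL = (if winding_number c z0 = 1 then 1 else 0)"
        "winding_number C pR = (if winding_number c z0 = 1 then 0 else -1)"
        using p(3) vals[OF p(1)] vals[OF p(2)] s0 by auto
      then show ?thesis using p(4)[OF norms(3)] p(5)[OF norms(3)] wA by simp
    qed
    \<comment> \<open>Two rotations of the triple turn the condition read from \<open>E\<close> into
      one read from \<open>F\<close>, where \<open>A\<close> comes after \<open>E\<close> and so
      lies on the right.\<close>
    have "ccw_angle w F E < ccw_angle w F A \<and> 0 < ccw_angle w F E"
      if "0 < ccw_angle w E A" "ccw_angle w E A < ccw_angle w E F"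
      using ccw_angle_cyclic[OF norms(2,3,1) \<rho>(1) that]
        ccw_angle_cyclic[OF norms(3,1,2) \<rho>(1)] by blast
    with sides show ?thesis unfolding F_def[symmetric] E_def[symmetric] A_def[symmetric]
      by (meson order.strict_trans)
  qed
  have ev: "eventually (\<lambda>\<rho>. \<rho> \<in> {0<..<m} \<and> exit_time w hF \<rho> < \<delta>0 \<and> exit_time w hE \<rho> < \<delta>1) (at_right 0)"
    by (intro eventually_conj eventually_at_right_real \<open>m > 0\<close> exit_time_tendsto_0[OF hFc hF0]
        exit_time_tendsto_0[OF hEc hE0] \<delta>0 \<delta>1 hFw hEw)
  show "eventually (\<lambda>\<rho>. 0 < ccw_angle w (X hF \<rho>) (X h \<rho>) \<and>
        ccw_angle w (X hF \<rho>) (X h \<rho>) < ccw_angle w (X hF \<rho>) (X hE \<rho>) \<longrightarrow>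
        winding_number c (h 1) = (if winding_number c z0 = 1 then 1 else 0)) (at_right 0)"
    using ev by eventually_elim (use main in auto)
  show "eventually (\<lambda>\<rho>. 0 < ccw_angle w (X hE \<rho>) (X h \<rho>) \<and>
        ccw_angle w (X hE \<rho>) (X h \<rho>) < ccw_angle w (X hE \<rho>) (X hF \<rho>) \<longrightarrow>
        winding_number c (h 1) = (if winding_number c z0 = 1 then 0 else -1)) (at_right 0)"
    using ev by eventually_elim (use main in auto)
qed

section \<open>Simple loops composed of paths\<close>

text \<open>New pieces are put in front: \<open>g i\<close> will be the edge entering the
  \<open>i\<close>-th ancestor, and passing to parents goes against the direction of the
  edges.\<close>

primrec path_chain :: "(nat \<Rightarrow> real \<Rightarrow> complex) \<Rightarrow> nat \<Rightarrow> real \<Rightarrow> complex" where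
  "path_chain g 0 = g 0"
| "path_chain g (Suc k) = g (Suc k) +++ path_chain g k"

locale joined_paths =
  fixes g :: "nat \<Rightarrow> real \<Rightarrow> complex" and pt :: "nat \<Rightarrow> complex"
  assumes simple: "simple_path (g i)"
    and start: "pathstart (g i) = pt (Suc i)" and finish: "pathfinish (g i) = pt i"
begin

lemma chain_ends: "pathstart (path_chain g k) = pt (Suc k)" "pathfinish (path_chain g k) = pt 0"
  by (induction k) (auto simp: start finish)

lemma path_chain: "path (path_chain g k)"
  by (induction k) (auto simp: simple simple_path_imp_path chain_ends finish)

lemma path_image_chain: "path_image (path_chain g k) = (\<Union>i\<le>k. path_image (g i))"
  by (induction k) (auto simp: path_image_join chain_ends finish atMost_Suc)

lemma winding_number_chain:
  "z \<notin> path_image (path_chain g k) \<Longrightarrow>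
    winding_number (path_chain g k) z = (\<Sum>i\<le>k. winding_number (g i) z)"
proof (induction k)
  case (Suc k)
  then have "z \<notin> path_image (g (Suc k))" "z \<notin> path_image (path_chain g k)"
    by (auto simp: path_image_join chain_ends finish)
  with Suc.IH show ?case
    by (simp add: winding_number_join simple simple_path_imp_path path_chain chain_ends finish)
qed simp

text \<open>Each further joining halves the parameter interval of \<open>g 0\<close>, so
  \<open>b\<close> is 2^-k. That the reparametrisation is affine is what later identifies the end of
  the loop with an edge-end at the vertex.\<close>

lemma chain_last:
  obtains b where "0 < b" "b \<le> 1" "\<And>t. t \<in> {0..1} \<Longrightarrow> path_chain g k (1 - b * (1 - t)) = g 0 t"
proof -
  have "\<exists>b. 0 < b \<and> b \<le> 1 \<and> (\<forall>t\<in>{0..1}. path_chain g k (1 - b * (1 - t)) = g 0 t)"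
  proof (induction k)
    case 0
    show ?case by (rule exI[of _ 1]) simp
  next
    case (Suc k)
    then obtain b where b: "0 < b" "b \<le> 1" "\<forall>t\<in>{0..1}. path_chain g k (1 - b * (1 - t)) = g 0 t" by blast
    have "path_chain g (Suc k) (1 - b / 2 * (1 - t)) = g 0 t" if t: "t \<in> {0..1}" for t
    \<comment> \<open>At the junction parameter 1/2 the joined path is evaluated on its first
      component, so the value has to be taken from the common endpoint.\<close>
    proof (cases "1 - b / 2 * (1 - t) = 1 / 2")
      case True
      have "b * (1 - t) \<le> b * 1" using b t by (intro mult_left_mono) auto
      with True b have "b * (1 - t) = 1" by simp
      then have "path_chain g k 0 = g 0 t" using b(3) t by force
      then show ?thesis
        using True finish[of "Suc k"] chain_ends(1)[of k] by (simp add: joinpaths_def pathstart_def pathfinish_def)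
    next
      case False
      have "b * (1 - t) \<le> 1" using b t by (intro mult_le_one) auto
      with False b have "\<not> 1 - b / 2 * (1 - t) \<le> 1 / 2" by auto
      moreover have "2 * (1 - b / 2 * (1 - t)) - 1 = 1 - b * (1 - t)" by (simp add: field_simps)
      ultimately show ?thesis using b(3) t by (simp only: path_chain.simps joinpaths_def if_False)
    qed
    with b show ?case by (intro exI[of _ "b / 2"]) auto
  qed
  with that show ?thesis by blast
qed

lemma chain_first:
  obtains a where "0 < a" "a \<le> 1" "\<And>t. t \<in> {0..1} \<Longrightarrow> path_chain g k (a * t) = g k t"
proof (cases k)
  case 0
  then show ?thesis by (intro that[of 1]) auto
next
  case (Suc n)
  then show ?thesis by (intro that[of "1 / 2"]) (auto simp: joinpaths_def)
qed

end

locale separated_paths = joined_paths +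
  fixes n :: nat
  assumes separated: "i < j \<Longrightarrow> j < n \<Longrightarrow>
      path_image (g i) \<inter> path_image (g j) \<subseteq> {pt i, pt (Suc i)} \<inter> {pt j, pt (Suc j)}"
begin

lemma arc_chain:
  assumes "inj_on pt {..Suc k}" "k < n"
  shows "arc (path_chain g k)"
  using assms
proof (induction k)
  case 0
  have "pt 1 \<noteq> pt 0" using 0(1) inj_onD[of pt "{..Suc 0}" 1 0] by auto
  then show ?case using simple by (auto intro!: simple_path_imp_arc simp: start finish)
next
  case (Suc k)
  have inj: "pt i = pt j \<longleftrightarrow> i = j" if "i \<le> Suc (Suc k)" "j \<le> Suc (Suc k)" for i j
    using inj_on_eq_iff[OF Suc.prems(1)] that by auto
  have "inj_on pt {..Suc k}" using Suc.prems(1) by (rule inj_on_subset) auto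
  with Suc have arc: "arc (path_chain g k)" by simp
  have "pathstart (g (Suc k)) \<noteq> pathfinish (g (Suc k))" using inj by (simp add: start finish)
  then have "arc (g (Suc k))" using simple by (simp add: simple_path_imp_arc)
  moreover have "path_image (g (Suc k)) \<inter> path_image (path_chain g k) \<subseteq> {pt (Suc k)}"
  proof
    fix z assume "z \<in> path_image (g (Suc k)) \<inter> path_image (path_chain g k)"
    then obtain i where i: "i \<le> k" "z \<in> path_image (g i) \<inter> path_image (g (Suc k))"
      by (auto simp: path_image_chain)
    then have "z \<in> {pt i, pt (Suc i)} \<inter> {pt (Suc k), pt (Suc (Suc k))}"
      using separated[of i "Suc k"] Suc.prems by fastforce
    then show "z \<in> {pt (Suc k)}" using inj i by auto
  qed
  ultimately show ?case using arc by (auto intro!: arc_join simp: chain_ends finish)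
qed

text \<open>For \<open>k = 0\<close> this is a loop edge. Otherwise the first \<open>k\<close>
  pieces \<open>g 0\<close>, ..., \<open>g (k - 1)\<close> form an arc, and \<open>g k\<close> is a
  second arc that meets it only at the two common endpoints.\<close>

lemma simple_loop_chain:
  assumes inj: "inj_on pt {..<n}" and loop: "pt n = pt 0" and n: "n = Suc k"
  shows "simple_path (path_chain g k)"
proof (cases k)
  case 0
  then show ?thesis using simple by simp
next
  case (Suc m)
  have inj': "pt i = pt j \<longleftrightarrow> i = j" if "i < n" "j < n" for i j
    using inj_on_eq_iff[OF inj] that by auto
  have "inj_on pt {..Suc m}" using inj by (rule inj_on_subset) (use n Suc in auto)
  then have arc: "arc (path_chain g m)" using n Suc by (intro arc_chain) auto
  have "pathstart (g k) \<noteq> pathfinish (g k)"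
    using inj'[of 0 k] n Suc loop by (simp add: start finish)
  then have "arc (g k)" using simple by (simp add: simple_path_imp_arc)
  moreover have "path_image (g k) \<inter> path_image (path_chain g m) \<subseteq> {pt 0, pt k}"
  proof
    fix z assume "z \<in> path_image (g k) \<inter> path_image (path_chain g m)"
    then obtain i where i: "i < k" "z \<in> path_image (g i) \<inter> path_image (g k)"
      using Suc by (auto simp: path_image_chain less_Suc_eq_le)
    then have "z \<in> {pt k, pt (Suc k)}" using separated[of i k] n by fastforce
    then show "z \<in> {pt 0, pt k}" using n loop by auto
  qed
  ultimately show ?thesis using arc n loop Suc
    by (auto intro!: simple_path_join_loop simp: chain_ends finish start)
qed

end

section \<open>Edges of a plane digraph\<close>

lemma exit_point_eq: "exit_point \<gamma> v \<rho> a = half_edge \<gamma> a (exit_time v (half_edge \<gamma> a) \<rho>)"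
  unfolding exit_point_def exit_time_def by simp

lemma half_edge_Out: "half_edge \<gamma> (Out e) t = \<gamma> e (t / 2)"
  by (simp add: subpath_def)

lemma half_edge_In: "half_edge \<gamma> (In e) t = \<gamma> e (1 - t / 2)"
  by (simp add: subpath_def algebra_simps)

context plane_digraph
begin

lemma edge_at_ends: "e \<in> arcs G \<Longrightarrow> \<gamma> e 0 = tail G e" "e \<in> arcs G \<Longrightarrow> \<gamma> e 1 = head G e"
  using edge_start edge_finish by (auto simp: pathstart_def pathfinish_def)

lemma continuous_edge: "e \<in> arcs G \<Longrightarrow> continuous_on {0..1} (\<gamma> e)"
  using edge_simple_path simple_path_imp_path path_def by blast

lemma edge_interior_not_vertex: "e \<in> arcs G \<Longrightarrow> 0 < t \<Longrightarrow> t < 1 \<Longrightarrow> \<gamma> e t \<notin> verts G"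
  using edge_avoids_verts[of e] by fastforce

lemma path_image_edge:
  assumes "e \<in> arcs G"
  shows "path_image (\<gamma> e) = \<gamma> e ` {0<..<1} \<union> {tail G e, head G e}"
proof -
  have "{0..1} = {0<..<1} \<union> {0, 1 :: real}" by auto
  then show ?thesis unfolding path_image_def using edge_at_ends[OF assms] by (simp add: image_Un insert_commute)
qed

lemma path_image_edges_Int:
  assumes "e \<in> arcs G" "f \<in> arcs G" "e \<noteq> f"
  shows "path_image (\<gamma> e) \<inter> path_image (\<gamma> f) \<subseteq> {tail G e, head G e} \<inter> {tail G f, head G f}"
proof
  fix z assume z: "z \<in> path_image (\<gamma> e) \<inter> path_image (\<gamma> f)"
  have inner: "z \<notin> \<gamma> e ` {0<..<1} \<or> z \<notin> \<gamma> f ` {0<..<1}" using edges_disjoint[OF assms] by blast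
  have vert: "z \<in> verts G \<Longrightarrow> z \<notin> \<gamma> e ` {0<..<1} \<and> z \<notin> \<gamma> f ` {0<..<1}"
    using edge_avoids_verts[OF assms(1)] edge_avoids_verts[OF assms(2)] by blast
  have "z \<in> verts G" if "z \<in> {tail G e, head G e} \<union> {tail G f, head G f}"
    using that assms(1,2) by auto
  with z inner vert show "z \<in> {tail G e, head G e} \<inter> {tail G f, head G f}"
    unfolding path_image_edge[OF assms(1)] path_image_edge[OF assms(2)] by blast
qed

lemma continuous_half_edge:
  assumes "e \<in> arcs G"
  shows "continuous_on {0..1} (half_edge \<gamma> (In e))" "continuous_on {0..1} (half_edge \<gamma> (Out e))"
proof -
  have "continuous_on {0..1} (\<lambda>t. \<gamma> e (1 - t / 2))" "continuous_on {0..1} (\<lambda>t. \<gamma> e (t / 2))"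
    by (rule continuous_on_compose2[OF continuous_edge[OF assms]]; auto intro!: continuous_intros)+
  then show "continuous_on {0..1} (half_edge \<gamma> (In e))" "continuous_on {0..1} (half_edge \<gamma> (Out e))"
    unfolding half_edge_In[abs_def, symmetric] half_edge_Out[abs_def, symmetric] by simp_all
qed

lemma eventually_exit_point_dist:
  assumes "a \<in> ends_at G v" "v \<in> verts G"
  shows "eventually (\<lambda>\<rho>. cmod (exit_point \<gamma> v \<rho> a - v) = \<rho> \<and> 0 < \<rho>) (at_right 0)"
proof -
  let ?h = "half_edge \<gamma> a"
  obtain e where e: "e \<in> arcs G" "a = Out e \<and> tail G e = v \<or> a = In e \<and> head G e = v"
    using assms(1) unfolding ends_at_def by auto
  have h: "continuous_on {0..1} ?h" "?h 0 = v" "?h 1 = \<gamma> e (1/2)"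
    using e(2) continuous_half_edge[OF e(1)] edge_at_ends[OF e(1)]
    by (elim disjE; simp add: half_edge_In half_edge_Out del: half_edge.simps)+
  have "?h 1 \<noteq> v" unfolding h using edge_interior_not_vertex[OF e(1), of "1/2"] assms(2) by auto
  then have "eventually (\<lambda>\<rho>. \<rho> \<in> {0<..<dist v (?h 1)}) (at_right 0)"
    by (intro eventually_at_right_real) auto
  then show ?thesis
  proof eventually_elim
    case (elim \<rho>)
    then show ?case using exit_time_dist(1)[OF h(1,2), of \<rho>]
      by (simp add: exit_point_eq dist_norm norm_minus_commute)
  qed
qed

end

section \<open>Cycles of a lattice point\<close>

locale clock_graph = plane_balanced_transverse_graph G \<gamma>
  for G :: "(complex, 'e) pre_digraph" and \<gamma> +
  fixes r :: complex and inc :: "complex \<Rightarrow> nat \<Rightarrow> 'e"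
  assumes labelling: "incoming_labelling G \<gamma> r inc"
    and root_vert: "r \<in> verts G"
    and root_outer: "\<exists>U\<in>components (- drawing G \<gamma>). \<not> bounded U \<and> r \<in> frontier U"

sublocale clock_graph \<subseteq> coordinate_parents "verts G - {r}" "in_degree G" "\<lambda>v j. tail G (inc v j)"
  by unfold_locales simp

context clock_graph
begin

lemma inc_bij: "v \<in> verts G - {r} \<Longrightarrow> bij_betw (inc v) {1..in_degree G v} (in_arcs G v)"
  using labelling unfolding incoming_labelling_def by blast

lemma inc_arc:
  assumes "v \<in> verts G - {r}" "j \<in> {1..in_degree G v}"
  shows "inc v j \<in> arcs G" "head G (inc v j) = v" "inc v j \<in> in_arcs G v"
proof -
  show "inc v j \<in> in_arcs G v" using bij_betwE[OF inc_bij[OF assms(1)]] assms(2) by blast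
  then show "inc v j \<in> arcs G" "head G (inc v j) = v" by auto
qed

lemma inc_eq_iff:
  assumes "v \<in> verts G - {r}" "i \<in> {1..in_degree G v}" "j \<in> {1..in_degree G v}"
  shows "inc v i = inc v j \<longleftrightarrow> i = j"
  using inc_bij[OF assms(1)] assms unfolding bij_betw_def by (auto dest: inj_onD)

text \<open>Consecutiveness provides some first incoming end \<open>a\<close>. It is the one
  labelled 1: otherwise \<open>a\<close>, \<open>In (inc v 1)\<close> and the outgoing end
  immediately before label 1 would be met in both cyclic orders.\<close>

lemma first_in_before_out:
  assumes v: "v \<in> verts G - {r}" and d: "1 < in_degree G v"
    and j: "j \<in> {2..in_degree G v}" and f: "f \<in> out_arcs G v"
  shows "ccw_order \<gamma> v (In (inc v 1)) (In (inc v j)) (Out f)"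
proof -
  let ?x = "\<lambda>a \<rho>. exit_point \<gamma> v \<rho> a"
  have vG: "v \<in> verts G" using v by blast
  have ins: "In ` in_arcs G v \<subseteq> ends_at G v" and outs: "Out ` out_arcs G v \<subseteq> ends_at G v - In ` in_arcs G v"
    unfolding ends_at_def by auto
  have a1: "inc v 1 \<in> in_arcs G v" using inc_arc(3)[OF v, of 1] d by simp
  obtain a where a: "a \<in> In ` in_arcs G v"
      "\<And>b c. b \<in> In ` in_arcs G v - {a} \<Longrightarrow> c \<in> ends_at G v - In ` in_arcs G v \<Longrightarrow> ccw_order \<gamma> v a b c"
    using in_consecutive[OF vG] a1 unfolding consecutive_ends_def by blast
  obtain f0 where f0: "f0 \<in> out_arcs G v" "ccw_next G \<gamma> v (Out f0) (In (inc v 1))"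
    using labelling v unfolding incoming_labelling_def by blast
  have "a = In (inc v 1)"
  proof (rule ccontr)
    assume ne: "a \<noteq> In (inc v 1)"
    have 1: "ccw_order \<gamma> v a (In (inc v 1)) (Out f0)"
      using a(2)[of "In (inc v 1)" "Out f0"] ne a1 f0(1) outs by blast
    have "a \<in> ends_at G v - {Out f0, In (inc v 1)}" using a(1) ne ins by auto
    then have 2: "ccw_order \<gamma> v (Out f0) (In (inc v 1)) a"
      using f0(2) unfolding ccw_next_def by blast
    have d: "eventually (\<lambda>\<rho>. cmod (?x b \<rho> - v) = \<rho> \<and> 0 < \<rho>) (at_right 0)"
      if "b \<in> {a, Out f0, In (inc v 1)}" for b
      by (rule eventually_exit_point_dist[OF _ vG]) (use that a(1) ins a1 f0(1) outs in blast)
    have "eventually (\<lambda>\<rho>. False) (at_right (0 :: real))"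
      using 1[unfolded ccw_order_def] 2[unfolded ccw_order_def]
        d[OF insertI1] d[OF insertI2[OF insertI1]] d[OF insertI2[OF insertI2[OF insertI1]]]
    proof eventually_elim
      case (elim \<rho>)
      then have p: "cmod (?x a \<rho> - v) = \<rho>" "cmod (?x (Out f0) \<rho> - v) = \<rho>"
        "cmod (?x (In (inc v 1)) \<rho> - v) = \<rho>" "\<rho> > 0" by simp_all
      from elim(1) have "ccw_angle v (?x a \<rho>) (?x (In (inc v 1)) \<rho>) < ccw_angle v (?x a \<rho>) (?x (Out f0) \<rho>)" by blast
      moreover note ccw_angle_cyclic[OF p(2,3,1,4)]
      then have "0 < ccw_angle v (?x (In (inc v 1)) \<rho>) (?x a \<rho>)"
        "ccw_angle v (?x (In (inc v 1)) \<rho>) (?x a \<rho>) < ccw_angle v (?x (In (inc v 1)) \<rho>) (?x (Out f0) \<rho>)"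
        using elim(2) by blast+
      from ccw_angle_cyclic(2)[OF p(3,1,2,4) this]
      have "ccw_angle v (?x a \<rho>) (?x (Out f0) \<rho>) < ccw_angle v (?x a \<rho>) (?x (In (inc v 1)) \<rho>)" .
      ultimately show False by simp
    qed
    then show False by (simp add: trivial_limit_at_right_real)
  qed
  moreover have "inc v j \<noteq> inc v 1" using inc_eq_iff[OF v, of j 1] j d by auto
  moreover have "inc v j \<in> in_arcs G v" using inc_arc(3)[OF v, of j] j by simp
  ultimately show ?thesis using a(2)[of "In (inc v j)" "Out f"] f outs by blast
qed

text \<open>Measured from the end labelled 1, angles increase with the label, and every outgoing end
  comes after all incoming ones. Both claims are rotations of this linear order.\<close>

lemma ccw_order_in_out:
  assumes v: "v \<in> verts G - {r}" and i: "i \<in> {1..in_degree G v}" and j: "j \<in> {1..in_degree G v}"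
    and ij: "i < j" and f: "f \<in> out_arcs G v"
  shows "ccw_order \<gamma> v (Out f) (In (inc v i)) (In (inc v j))"
    "ccw_order \<gamma> v (In (inc v i)) (In (inc v j)) (Out f)"
proof -
  let ?x = "\<lambda>a \<rho>. exit_point \<gamma> v \<rho> a"
  let ?a = "\<lambda>i. In (inc v i)"
  let ?\<alpha> = "\<lambda>\<rho> b. ccw_angle v (?x (?a 1) \<rho>) (?x b \<rho>)"
  have vG: "v \<in> verts G" using v by blast
  have d: "1 < in_degree G v" using i j ij by auto
  have j2: "j \<in> {2..in_degree G v}" using i j ij by auto
  have 1: "eventually (\<lambda>\<rho>. 0 < ?\<alpha> \<rho> (?a k) \<and> ?\<alpha> \<rho> (?a k) < ?\<alpha> \<rho> (Out f)) (at_right 0)"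
    if "k \<in> {2..in_degree G v}" for k
    using first_in_before_out[OF v d that f] unfolding ccw_order_def .
  have "ccw_order \<gamma> v (?a 1) (?a i) (?a j)" if "i \<noteq> 1"
    using labelling v i j ij that unfolding incoming_labelling_def by auto
  \<comment> \<open>\<open>ccw_order\<close> requires a positive first angle, so label 1 is treated
    separately: its angle to itself is 0.\<close>
  then have 2: "eventually (\<lambda>\<rho>. i \<noteq> 1 \<longrightarrow> ?\<alpha> \<rho> (?a i) < ?\<alpha> \<rho> (?a j)) (at_right 0)"
    unfolding ccw_order_def by (cases "i = 1") (simp, rule eventually_mono, blast+)
  have dist: "eventually (\<lambda>\<rho>. cmod (?x b \<rho> - v) = \<rho> \<and> 0 < \<rho>) (at_right 0)"
    if "b \<in> {?a 1, ?a i, ?a j, Out f}" for b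
  proof (rule eventually_exit_point_dist[OF _ vG])
    show "b \<in> ends_at G v" using that f inc_arc(3)[OF v] i j d unfolding ends_at_def by auto
  qed
  have ev: "eventually (\<lambda>\<rho>. (0 < ccw_angle v (?x (Out f) \<rho>) (?x (?a i) \<rho>) \<and>
        ccw_angle v (?x (Out f) \<rho>) (?x (?a i) \<rho>) < ccw_angle v (?x (Out f) \<rho>) (?x (?a j) \<rho>)) \<and>
      (0 < ccw_angle v (?x (?a i) \<rho>) (?x (?a j) \<rho>) \<and>
        ccw_angle v (?x (?a i) \<rho>) (?x (?a j) \<rho>) < ccw_angle v (?x (?a i) \<rho>) (?x (Out f) \<rho>))) (at_right 0)"
    using 1[OF j2] 2 dist[OF insertI1] dist[OF insertI2[OF insertI1]]
      dist[OF insertI2[OF insertI2[OF insertI1]]] dist[OF insertI2[OF insertI2[OF insertI2[OF insertI1]]]]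
  proof eventually_elim
    case (elim \<rho>)
    let ?p = "?x (?a 1) \<rho>"
    have pv: "?p \<noteq> v" using elim(3) by auto
    have eqs: "cmod (?p - v) = cmod (?x (?a i) \<rho> - v)" "cmod (?p - v) = cmod (?x (?a j) \<rho> - v)"
      "cmod (?p - v) = cmod (?x (Out f) \<rho> - v)" using elim(3-6) by simp_all
    note diff = ccw_angle_diff[OF eqs(1,3) pv] ccw_angle_diff[OF eqs(2,3) pv] ccw_angle_diff[OF eqs(1,2) pv]
    have "?\<alpha> \<rho> (?a i) < ?\<alpha> \<rho> (?a j)"
    proof (cases "i = 1")
      case True
      then show ?thesis using elim(1) ccw_angle_refl[OF pv] by simp
    next
      case False
      then show ?thesis using elim(2) by simp
    qed
    moreover have "?\<alpha> \<rho> (?a j) < ?\<alpha> \<rho> (Out f)" using elim(1) by blast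
    moreover have "0 \<le> ?\<alpha> \<rho> (?a i)" "?\<alpha> \<rho> (Out f) < 2 * pi" by (rule ccw_angle_bounds)+
    ultimately show ?case by (simp add: diff)
  qed
  show "ccw_order \<gamma> v (Out f) (?a i) (?a j)" "ccw_order \<gamma> v (?a i) (?a j) (Out f)"
    using ev unfolding ccw_order_def eventually_conj_iff by simp_all
qed

end

lemma exit_time_cong:
  assumes "\<And>t. t \<in> {0..1} \<Longrightarrow> h t = k t"
  shows "exit_time w h \<rho> = exit_time w k \<rho>"
  unfolding exit_time_def using assms by (intro arg_cong[of _ _ Sup]) auto

context clock_graph
begin

section \<open>The closed curve of a cycle and the edges on its two sides\<close>

definition chosen :: "(complex \<Rightarrow> nat) \<Rightarrow> complex \<Rightarrow> 'e" where
  "chosen x v = inc v (x v)"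

lemma points_bounds: "x \<in> points \<Longrightarrow> v \<in> verts G - {r} \<Longrightarrow> x v \<in> {1..in_degree G v}"
  unfolding points_def by (auto simp: PiE_iff)

lemma chosen_arc:
  assumes "x \<in> points" "v \<in> verts G - {r}"
  shows "chosen x v \<in> arcs G" "head G (chosen x v) = v" "tail G (chosen x v) = parent x v"
  using inc_arc[OF assms(2) points_bounds[OF assms]] by (auto simp: chosen_def parent_def)

definition curve :: "(complex \<Rightarrow> nat) \<Rightarrow> complex set \<Rightarrow> complex set" where
  "curve x C = (\<Union>v\<in>C. path_image (\<gamma> (chosen x v)))"

text \<open>Written as a sum over edges, the winding number of the cycle does not depend on where
  the loop is started, so the orientation is decided once for all vertices of
  \<open>C\<close>.\<close>

definition curve_winding :: "(complex \<Rightarrow> nat) \<Rightarrow> complex set \<Rightarrow> complex \<Rightarrow> complex" where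
  "curve_winding x C z = (\<Sum>v\<in>C. winding_number (\<gamma> (chosen x v)) z)"

lemma edge_interior_not_curve:
  assumes x: "x \<in> points" and C: "C \<subseteq> verts G - {r}" and e: "e \<in> arcs G" "e \<notin> chosen x ` C" and t: "0 < t" "t < 1"
  shows "\<gamma> e t \<notin> curve x C"
proof
  assume "\<gamma> e t \<in> curve x C"
  then obtain v where v: "v \<in> C" "\<gamma> e t \<in> path_image (\<gamma> (chosen x v))" unfolding curve_def by blast
  have f: "chosen x v \<in> arcs G" using chosen_arc[OF x] v C by blast
  have "\<gamma> e t \<in> path_image (\<gamma> e)" using t unfolding path_image_def by (auto intro: imageI)
  then have "\<gamma> e t \<in> {tail G e, head G e}" using path_image_edges_Int[OF e(1) f] v e(2) by blast
  then have "\<gamma> e t \<in> verts G" using e(1) by auto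
  then show False using edge_interior_not_vertex[OF e(1) t] by blast
qed

lemma curve_verts:
  assumes x: "x \<in> points" and C: "orbit_cycle (verts G - {r}) (parent x) C"
  shows "curve x C \<inter> verts G \<subseteq> C"
proof
  fix u assume u: "u \<in> curve x C \<inter> verts G"
  then obtain v where v: "v \<in> C" "u \<in> path_image (\<gamma> (chosen x v))" unfolding curve_def by blast
  then have vN: "v \<in> verts G - {r}" using orbit_cycleD(1)[OF C] by blast
  note ca = chosen_arc[OF x vN]
  from v u edge_avoids_verts[OF ca(1)] have "u = parent x v \<or> u = v"
    unfolding path_image_edge[OF ca(1)] ca by auto
  then show "u \<in> C" using v orbit_cycle_step[OF C] by blast
qed

text \<open>Starting the loop at the vertex \<open>w\<close> under examination makes the outgoing
  edge of the cycle at \<open>w\<close> its first piece and the incoming edge its last one.\<close>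

lemma cycle_loop:
  assumes x: "x \<in> points" and C: "orbit_cycle (verts G - {r}) (parent x) C" and w: "w \<in> C"
  obtains c a b u where "simple_path c" "pathstart c = w" "pathfinish c = w"
    "path_image c = curve x C" "\<And>z. z \<notin> curve x C \<Longrightarrow> winding_number c z = curve_winding x C z"
    "0 < a" "a \<le> 1" "0 < b" "b \<le> 1" "u \<in> C" "parent x u = w"
    "\<And>t. t \<in> {0..1} \<Longrightarrow> c (a * t) = \<gamma> (chosen x u) t"
    "\<And>t. t \<in> {0..1} \<Longrightarrow> c (1 - b * (1 - t)) = \<gamma> (chosen x w) t"
proof -
  define pt where "pt i = (parent x ^^ i) w" for i
  define g where "g i = \<gamma> (chosen x (pt i))" for i
  obtain n where n: "n > 0" "pt n = w" "inj_on pt {..<n}" "C = pt ` {..<n}"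
    using orbit_cycle_period[OF C w] unfolding pt_def by blast
  have ptC: "pt i \<in> C" for i unfolding pt_def by (rule orbit_cycle_closed[OF C w])
  have CN: "C \<subseteq> verts G - {r}" using C by (rule orbit_cycleD)
  have ptN: "pt i \<in> verts G - {r}" for i using ptC CN by blast
  note ca = chosen_arc[OF x ptN]
  have step: "parent x (pt i) = pt (Suc i)" for i unfolding pt_def by simp
  interpret separated_paths g pt n
  proof
    fix i j
    show "simple_path (g i)" unfolding g_def by (rule edge_simple_path[OF ca(1)])
    show "pathstart (g i) = pt (Suc i)" "pathfinish (g i) = pt i"
      unfolding g_def by (simp_all only: edge_start[OF ca(1)] edge_finish[OF ca(1)] ca step)
    assume ij: "i < j" "j < n"
    then have "pt i \<noteq> pt j" using inj_onD[OF n(3), of i j] by auto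
    then have "chosen x (pt i) \<noteq> chosen x (pt j)" using ca(2)[of i] ca(2)[of j] by auto
    from path_image_edges_Int[OF ca(1) ca(1) this]
    show "path_image (g i) \<inter> path_image (g j) \<subseteq> {pt i, pt (Suc i)} \<inter> {pt j, pt (Suc j)}"
      unfolding g_def ca step by blast
  qed
  obtain k where k: "n = Suc k" using n(1) gr0_implies_Suc by blast
  have im: "C = pt ` {..k}" unfolding n(4) k by (simp add: lessThan_Suc_atMost)
  have inj: "inj_on pt {..k}" using n(3) unfolding k by (simp add: lessThan_Suc_atMost)
  have pt0: "pt 0 = w" unfolding pt_def by simp
  have img: "path_image (path_chain g k) = curve x C"
    unfolding path_image_chain curve_def im g_def by simp
  have wn: "winding_number (path_chain g k) z = curve_winding x C z" if "z \<notin> curve x C" for z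
    using that winding_number_chain[of z k] sum.reindex[OF inj, of "\<lambda>v. winding_number (\<gamma> (chosen x v)) z"]
    unfolding curve_winding_def im[symmetric] img g_def comp_def by simp
  obtain b where b: "0 < b" "b \<le> 1" "\<And>t. t \<in> {0..1} \<Longrightarrow> path_chain g k (1 - b * (1 - t)) = g 0 t"
    using chain_last by blast
  obtain a where a: "0 < a" "a \<le> 1" "\<And>t. t \<in> {0..1} \<Longrightarrow> path_chain g k (a * t) = g k t"
    using chain_first by blast
  show thesis
  \<comment> \<open>\<open>pt k\<close> is the last point before the orbit returns to
    \<open>w\<close>, that is, the child of \<open>w\<close> on the cycle; for a loop edge it is
    \<open>w\<close> itself.\<close>
  proof (rule that[of "path_chain g k" a b "pt k"])
    show "simple_path (path_chain g k)"
      by (rule simple_loop_chain[OF n(3) _ k]) (simp only: n(2) pt0)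
    show "pathstart (path_chain g k) = w" "pathfinish (path_chain g k) = w"
      unfolding chain_ends pt0 k[symmetric] n(2) by simp_all
    show "parent x (pt k) = w" unfolding step k[symmetric] n(2) ..
    show "path_chain g k (1 - b * (1 - t)) = \<gamma> (chosen x w) t" if "t \<in> {0..1}" for t
      using b(3)[OF that] by (simp add: g_def pt0)
    show "path_chain g k (a * t) = \<gamma> (chosen x (pt k)) t" if "t \<in> {0..1}" for t
      using a(3)[OF that] by (simp add: g_def)
  qed (use img wn a b ptC in auto)
qed

text \<open>By \<open>ccw_order_in_out\<close> the ends with smaller labels leave on the left of the
  loop and those with larger labels on the right. \<open>simple_loop_sides\<close> then gives
  winding number 1 or -1 at the midpoint of the edge, and a nonzero winding number means
  inside.\<close>

lemma labels_on_sides: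
  assumes x: "x \<in> points" and C: "orbit_cycle (verts G - {r}) (parent x) C" and w: "w \<in> C"
    and i: "i \<in> {1..in_degree G w}" and z0: "z0 \<in> inside (curve x C)"
  shows "curve_winding x C z0 = 1 \<Longrightarrow> i < x w \<Longrightarrow> \<gamma> (inc w i) (1/2) \<in> inside (curve x C)"
    and "curve_winding x C z0 \<noteq> 1 \<Longrightarrow> x w < i \<Longrightarrow> \<gamma> (inc w i) (1/2) \<in> inside (curve x C)"
proof -
  have CN: "C \<subseteq> verts G - {r}" using C by (rule orbit_cycleD)
  then have wN: "w \<in> verts G - {r}" using w by blast
  obtain c a b u where c: "simple_path c" "pathstart c = w" "pathfinish c = w"
    "path_image c = curve x C" "\<And>z. z \<notin> curve x C \<Longrightarrow> winding_number c z = curve_winding x C z"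
    and ab: "0 < a" "a \<le> 1" "0 < b" "b \<le> 1" and u: "u \<in> C" "parent x u = w"
    "\<And>t. t \<in> {0..1} \<Longrightarrow> c (a * t) = \<gamma> (chosen x u) t"
    "\<And>t. t \<in> {0..1} \<Longrightarrow> c (1 - b * (1 - t)) = \<gamma> (chosen x w) t"
    using cycle_loop[OF x C w] by blast
  have uN: "u \<in> verts G - {r}" using u(1) CN by blast
  let ?e = "chosen x w" and ?f = "chosen x u" and ?h = "half_edge \<gamma> (In (inc w i))"
  define hF where "hF = (\<lambda>t. c (a * t / 2))"
  define hE where "hE = (\<lambda>t. c (1 - b * t / 2))"
  have ia: "inc w i \<in> arcs G" "head G (inc w i) = w" using inc_arc[OF wN i] by auto
  have f: "?f \<in> out_arcs G w" using chosen_arc[OF x uN] u(2) by auto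
  have F: "hF t = half_edge \<gamma> (Out ?f) t" if "t \<in> {0..1}" for t
    using u(3)[of "t / 2"] that unfolding hF_def half_edge_Out by simp
  have E: "hE t = half_edge \<gamma> (In ?e) t" if "t \<in> {0..1}" for t
    using u(4)[of "1 - t / 2"] that unfolding hE_def half_edge_In by simp
  have ex: "hF (exit_time w hF \<rho>) = exit_point \<gamma> w \<rho> (Out ?f)"
    "hE (exit_time w hE \<rho>) = exit_point \<gamma> w \<rho> (In ?e)" if "0 < \<rho>" for \<rho>
  proof -
    have ea: "?e \<in> arcs G" "head G ?e = w" "?f \<in> arcs G" "tail G ?f = w"
      using chosen_arc[OF x wN] f by auto
    have 0: "half_edge \<gamma> (Out ?f) 0 = w" "half_edge \<gamma> (In ?e) 0 = w"
      unfolding half_edge_Out half_edge_In using edge_at_ends ea by auto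
    have T: "exit_time w hF \<rho> = exit_time w (half_edge \<gamma> (Out ?f)) \<rho>"
      "exit_time w hE \<rho> = exit_time w (half_edge \<gamma> (In ?e)) \<rho>"
      by (rule exit_time_cong; erule F E)+
    have "exit_time w (half_edge \<gamma> (Out ?f)) \<rho> \<in> {0..1}" "exit_time w (half_edge \<gamma> (In ?e)) \<rho> \<in> {0..1}"
      using exit_time_mem(1)[OF continuous_half_edge(2)[OF ea(3)] 0(1)]
        exit_time_mem(1)[OF continuous_half_edge(1)[OF ea(1)] 0(2)] that by simp_all
    then show "hF (exit_time w hF \<rho>) = exit_point \<gamma> w \<rho> (Out ?f)"
      "hE (exit_time w hE \<rho>) = exit_point \<gamma> w \<rho> (In ?e)"
      unfolding exit_point_eq T by (simp_all only: F E)
  qed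
  have z0c: "winding_number c z0 = curve_winding x C z0"
    using c(5) z0 inside_no_overlap[of "curve x C"] by blast
  have mid: "?h 1 = \<gamma> (inc w i) (1/2)" unfolding half_edge_In by simp
  have notC: "inc w i \<notin> chosen x ` C" if ne: "i \<noteq> x w"
  proof
    assume "inc w i \<in> chosen x ` C"
    then obtain v where v: "v \<in> C" "inc w i = inc v (x v)" unfolding chosen_def by blast
    have vN: "v \<in> verts G - {r}" using v CN by blast
    have "v = w" using chosen_arc(2)[OF x vN] v(2) ia unfolding chosen_def by simp
    then show False using v(2) inc_eq_iff[OF wN i points_bounds[OF x wN]] ne by simp
  qed
  have main: "\<gamma> (inc w i) (1/2) \<in> inside (curve x C)"
    if ne: "i \<noteq> x w" and eq: "winding_number c (?h 1) \<noteq> 0"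
  proof (rule ccontr)
    assume "\<gamma> (inc w i) (1/2) \<notin> inside (curve x C)"
    moreover have "\<gamma> (inc w i) (1/2) \<notin> curve x C"
      using notC[OF ne] edge_interior_not_curve[OF x CN ia(1), of "1/2"] by simp
    ultimately have "?h 1 \<in> outside (path_image c)"
      using inside_Un_outside[of "curve x C"] unfolding mid c(4) by blast
    then have "winding_number c (?h 1) = 0"
      using c by (intro winding_number_zero_in_outside) (auto simp: simple_path_imp_path)
    with eq show False by contradiction
  qed
  have avoid: "?h ` {0<..1} \<inter> path_image c = {}" if "i \<noteq> x w"
  proof -
    have "?h t \<notin> curve x C" if "t \<in> {0<..1}" for t
      unfolding half_edge_In
      by (intro edge_interior_not_curve[OF x CN ia(1) notC[OF \<open>i \<noteq> x w\<close>]]) (use that in auto)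
    then show ?thesis unfolding c(4) by blast
  qed
  have fold: "c (a * t / 2) = hF t" "c (1 - b * t / 2) = hE t" for t
    unfolding hF_def hE_def by simp_all
  have h0: "?h 0 = w" unfolding half_edge_In using edge_at_ends[OF ia(1)] ia(2) by simp
  have z0': "z0 \<in> inside (path_image c)" using z0 c(4) by simp
  have pos: "eventually (\<lambda>\<rho>::real. 0 < \<rho>) (at_right 0)" by (rule eventually_at_right_less)
  {
    assume s: "curve_winding x C z0 = 1" and lt: "i < x w"
    have "ccw_order \<gamma> w (Out ?f) (In (inc w i)) (In ?e)"
      unfolding chosen_def[of x w] by (rule ccw_order_in_out(1)[OF wN i points_bounds[OF x wN] lt f])
    then have "eventually (\<lambda>\<rho>. winding_number c (?h 1) = 1) (at_right (0::real))"
      using simple_loop_sides(1)[OF c(1-3) ab continuous_half_edge(1)[OF ia(1)] h0 avoid[OF less_imp_neq[OF lt]] z0',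
          folded hF_def hE_def, unfolded fold] pos
      unfolding ccw_order_def
    proof eventually_elim
      case (elim \<rho>)
      then show ?case using ex[of \<rho>] z0c s by (simp add: exit_point_eq[of _ _ _ "In (inc w i)"] del: half_edge.simps)
    qed
    then have "winding_number c (?h 1) = 1" by (simp add: trivial_limit_at_right_real)
    then show "\<gamma> (inc w i) (1/2) \<in> inside (curve x C)" using main lt by simp
  next
    assume s: "curve_winding x C z0 \<noteq> 1" and lt: "x w < i"
    have "ccw_order \<gamma> w (In ?e) (In (inc w i)) (Out ?f)"
      unfolding chosen_def[of x w] by (rule ccw_order_in_out(2)[OF wN points_bounds[OF x wN] i lt f])
    then have "eventually (\<lambda>\<rho>. winding_number c (?h 1) = -1) (at_right (0::real))"
      using simple_loop_sides(2)[OF c(1-3) ab continuous_half_edge(1)[OF ia(1)] h0 avoid[OF less_imp_neq[OF lt, symmetric]] z0',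
          folded hF_def hE_def, unfolded fold] pos
      unfolding ccw_order_def
    proof eventually_elim
      case (elim \<rho>)
      then show ?case using ex[of \<rho>] z0c s by (simp add: exit_point_eq[of _ _ _ "In (inc w i)"] del: half_edge.simps)
    qed
    then have "winding_number c (?h 1) = -1" by (simp add: trivial_limit_at_right_real)
    then show "\<gamma> (inc w i) (1/2) \<in> inside (curve x C)" using main lt by simp
  }
qed

section \<open>Trees that would be trapped by a cycle\<close>

lemma closed_curve:
  assumes x: "x \<in> points" and C: "C \<subseteq> verts G - {r}"
  shows "closed (curve x C)"
proof -
  have "finite C" using C finite_subset[of C "verts G"] by auto
  moreover have "closed (path_image (\<gamma> (chosen x v)))" if "v \<in> C" for v
    using chosen_arc(1)[OF x, of v] C that edge_simple_path simple_path_imp_path closed_path_image by blast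
  ultimately show ?thesis unfolding curve_def by (intro closed_UN) auto
qed

text \<open>The inside is open, so an unbounded face with \<open>r\<close> on its frontier would
  meet it. Being connected and off the curve, that face would lie in one bounded component.\<close>

lemma root_not_inside:
  assumes x: "x \<in> points" and C: "C \<subseteq> verts G - {r}"
  shows "r \<notin> inside (curve x C)"
proof
  assume r: "r \<in> inside (curve x C)"
  obtain U where U: "U \<in> components (- drawing G \<gamma>)" "\<not> bounded U" "r \<in> frontier U"
    using root_outer by blast
  have "open (inside (curve x C))" using closed_curve[OF x C] by (rule open_inside)
  moreover have "r \<in> closure U" using U(3) unfolding frontier_def by blast
  ultimately have "U \<inter> inside (curve x C) \<noteq> {}"
    using r open_Int_closure_eq_empty[of "inside (curve x C)" U] by blast
  then obtain q where q: "q \<in> U" "q \<in> inside (curve x C)" by blast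
  have "curve x C \<subseteq> drawing G \<gamma>"
    unfolding curve_def drawing_def using chosen_arc(1)[OF x] C by blast
  then have "U \<subseteq> - curve x C" using in_components_subset[OF U(1)] by blast
  then have "U \<subseteq> connected_component_set (- curve x C) q"
    using q(1) in_components_connected[OF U(1)] by (intro connected_component_maximal)
  moreover have "bounded (connected_component_set (- curve x C) q)"
    using q(2) unfolding inside_def by blast
  ultimately show False using U(2) bounded_subset by blast
qed

text \<open>The set closed under \<open>parent y\<close> consists of the non-root vertices on
  \<open>C\<close> or inside the curve. An edge of the cycle leads back to \<open>C\<close>; any
  other one has its interior inside the curve, so its tail is in the closure of the inside, and a
  vertex on the curve belongs to \<open>C\<close>.\<close>

lemma not_tree_if_trapped:
  assumes x: "x \<in> points" and C: "orbit_cycle (verts G - {r}) (parent x) C" and y: "y \<in> points"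
    and trapped: "\<And>w. w \<in> C \<Longrightarrow> y w = x w \<or> \<gamma> (chosen y w) (1/2) \<in> inside (curve x C)"
  shows "\<not> tree y"
proof -
  let ?I = "inside (curve x C)"
  have CN: "C \<subseteq> verts G - {r}" "C \<noteq> {}" using C by (rule orbit_cycleD)+
  let ?Z = "(C \<union> ?I) \<inter> (verts G - {r})"
  have "parent y v \<in> ?Z" if v: "v \<in> ?Z" for v
  proof -
    have vN: "v \<in> verts G - {r}" using v by blast
    let ?e = "chosen y v"
    note e = chosen_arc[OF y vN]
    show ?thesis
    proof (cases "v \<in> C \<and> y v = x v")
      case True
      then have "parent y v \<in> C" using orbit_cycle_step[OF C, of v] by (simp add: parent_def)
      then show ?thesis using CN by blast
    next
      case False
      have "?e \<notin> chosen x ` C"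
      proof
        assume "?e \<in> chosen x ` C"
        then obtain u where u: "u \<in> C" "?e = chosen x u" by blast
        then have "u \<in> verts G - {r}" using CN by blast
        then have "u = v" using e(2) chosen_arc(2)[OF x] u(2) by simp
        then show False using u False inc_eq_iff[OF vN points_bounds[OF y vN] points_bounds[OF x vN]]
          unfolding chosen_def by simp
      qed
      then have int: "\<gamma> ?e t \<notin> curve x C" if "0 < t" "t < 1" for t
        using edge_interior_not_curve[OF x CN(1) e(1)] that by blast
      \<comment> \<open>Used with two parameter sets: from an inside head back to the midpoint, and
        then from the midpoint over the open edge, whose tail may lie on the curve.\<close>
      have stay: "\<gamma> ?e s \<in> ?I"
        if "\<gamma> ?e ` T \<inter> curve x C = {}" "convex T" "T \<subseteq> {0..1}" "t \<in> T" "s \<in> T" "\<gamma> ?e t \<in> ?I" for T s t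
      proof -
        have "Topological_Spaces.connected (\<gamma> ?e ` T)"
          using that continuous_edge[OF e(1)]
          by (intro connected_continuous_image convex_connected) (auto elim: continuous_on_subset)
        then have "\<gamma> ?e ` T \<subseteq> connected_component_set (- curve x C) (\<gamma> ?e t)"
          using that by (intro connected_component_maximal) auto
        then have "connected_component (- curve x C) (\<gamma> ?e t) (\<gamma> ?e s)" using that(5) by auto
        then show ?thesis using inside_same_component that(6) by blast
      qed
      have mid: "\<gamma> ?e (1/2) \<in> ?I"
      proof (cases "v \<in> C")
        case True
        with False trapped show ?thesis by blast
      next
        case notC: False
        then have vI: "\<gamma> ?e 1 \<in> ?I" using v edge_at_ends(2)[OF e(1)] e(2) by auto
        have "\<gamma> ?e ` {1/2..1} \<inter> curve x C = {}"
        proof (rule equals0I)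
          fix z assume "z \<in> \<gamma> ?e ` {1/2..1} \<inter> curve x C"
          then obtain t where t: "1/2 \<le> t" "t \<le> 1" "\<gamma> ?e t \<in> curve x C" by auto
          show False
          proof (cases "t = 1")
            case True
            then show ?thesis using t vI inside_no_overlap[of "curve x C"] by blast
          next
            case False
            then show ?thesis using t int[of t] by simp
          qed
        qed
        from stay[OF this _ _ _ _ vI] show ?thesis by simp
      qed
      have "\<gamma> ?e s \<in> ?I" if "s \<in> {0<..<1}" for s
        using stay[of "{0<..<1}" "1/2" s] mid int that by fastforce
      then have "\<gamma> ?e ` {0<..<1} \<subseteq> ?I" by blast
      \<comment> \<open>The tail has parameter 0, outside the open interval, and is reached as a
        limit.\<close>
      moreover have "\<gamma> ?e ` closure {0<..<1} \<subseteq> closure (\<gamma> ?e ` {0<..<1})"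
        using continuous_edge[OF e(1)] by (intro continuous_image_closure_subset[of "{0..1}"]) auto
      then have "\<gamma> ?e 0 \<in> closure (\<gamma> ?e ` {0<..<1})" by auto
      ultimately have "\<gamma> ?e 0 \<in> closure ?I" using closure_mono by blast
      then have "\<gamma> ?e 0 \<in> curve x C \<union> ?I"
        using closure_inside_subset[OF closed_curve[OF x CN(1)]] by blast
      then have "parent y v \<in> curve x C \<union> ?I" using edge_at_ends(1)[OF e(1)] e(3) by simp
      moreover have "parent y v \<in> verts G" using e tail_in_verts by metis
      ultimately have "parent y v \<in> C \<union> ?I" using curve_verts[OF x C] by blast
      then show ?thesis
        using \<open>parent y v \<in> verts G\<close> CN root_not_inside[OF x CN(1)] by blast
    qed
  qed
  then have "parent y ` ?Z \<subseteq> ?Z" by blast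
  moreover have "?Z \<noteq> {}" using CN by blast
  ultimately show ?thesis unfolding tree_def rooted_def by blast
qed

lemma cycle_side:
  assumes x: "x \<in> points" and C: "orbit_cycle (verts G - {r}) (parent x) C"
  shows "(\<forall>y. tree y \<longrightarrow> (\<exists>w\<in>C. x w < y w)) \<or> (\<forall>y. tree y \<longrightarrow> (\<exists>w\<in>C. y w < x w))"
proof -
  have CN: "C \<subseteq> verts G - {r}" "C \<noteq> {}" using C by (rule orbit_cycleD)+
  then obtain w where w: "w \<in> C" by blast
  obtain c where "simple_path c" "pathstart c = w" "pathfinish c = w" "path_image c = curve x C"
    using cycle_loop[OF x C w] by metis
  then have "inside (curve x C) \<noteq> {}" using Jordan_inside_outside[of c] by simp
  then obtain z0 where z0: "z0 \<in> inside (curve x C)" by blast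
  note sides = labels_on_sides[OF x C _ _ z0]
  have yb: "y w \<in> {1..in_degree G w}" if "tree y" "w \<in> C" for y w
    using points_bounds[of y w] that CN unfolding tree_def by blast
  show ?thesis
  \<comment> \<open>The value 1 means that the cycle runs counter-clockwise, with its left side
    inside.\<close>
  proof (cases "curve_winding x C z0 = 1")
    case True
    have "\<exists>w\<in>C. x w < y w" if y: "tree y" for y
    proof (rule ccontr)
      assume "\<not> (\<exists>w\<in>C. x w < y w)"
      then have "y w = x w \<or> \<gamma> (chosen y w) (1/2) \<in> inside (curve x C)" if "w \<in> C" for w
        using sides(1)[OF that yb[OF y that] True] that unfolding chosen_def by (meson linorder_neqE_nat)
      from not_tree_if_trapped[OF x C _ this] y show False unfolding tree_def by blast
    qed
    then show ?thesis by blast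
  next
    case False
    have "\<exists>w\<in>C. y w < x w" if y: "tree y" for y
    proof (rule ccontr)
      assume "\<not> (\<exists>w\<in>C. y w < x w)"
      then have "y w = x w \<or> \<gamma> (chosen y w) (1/2) \<in> inside (curve x C)" if "w \<in> C" for w
        using sides(2)[OF that yb[OF y that] False] that unfolding chosen_def by (meson linorder_neqE_nat)
      from not_tree_if_trapped[OF x C _ this] y show False unfolding tree_def by blast
    qed
    then show ?thesis by blast
  qed
qed

end

section \<open>Trees and lattice points\<close>

lemma cas_tails:
  assumes "pre_digraph.cas H u p v" "e \<in> set p"
  shows "tail H e = u \<or> tail H e \<in> head H ` set p"
  using assms by (induction p arbitrary: u) (auto simp: pre_digraph.cas.simps)

lemma cas_last_head:
  assumes "pre_digraph.cas H u p v" "p \<noteq> []"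
  shows "v \<in> head H ` set p"
  using assms
proof (induction p arbitrary: u)
  case (Cons e p)
  then show ?case by (cases "p = []") (auto simp: pre_digraph.cas.simps)
qed simp

context clock_graph
begin

definition tree_graph :: "(complex \<Rightarrow> nat) \<Rightarrow> (complex, 'e) pre_digraph" where
  "tree_graph x = \<lparr>verts = verts G, arcs = chosen x ` (verts G - {r}), tail = tail G, head = head G\<rparr>"

lemma tree_graph_simps [simp]:
  "verts (tree_graph x) = verts G" "arcs (tree_graph x) = chosen x ` (verts G - {r})"
  "tail (tree_graph x) = tail G" "head (tree_graph x) = head G"
  by (simp_all add: tree_graph_def)

lemma represents_tree_graph:
  assumes x: "x \<in> points"
  shows "represents G r inc x (tree_graph x)"
proof -
  have arcs: "arcs (tree_graph x) \<subseteq> arcs G" using chosen_arc(1)[OF x] by auto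
  then have "wf_digraph (tree_graph x)" by unfold_locales auto
  then have "spanning (tree_graph x) G"
    unfolding spanning_def subgraph_def compatible_def using arcs wf_digraph by auto
  then show ?thesis unfolding represents_def by (simp add: chosen_def)
qed

text \<open>Acyclicity is where \<open>rooted\<close> enters: the heads of the arcs of an oriented
  cycle form a nonempty set closed under \<open>parent x\<close>, since each tail is the head of
  another arc of the cycle or its base point, which is also a head.\<close>

lemma oriented_spanning_tree_tree_graph:
  assumes "tree x"
  shows "oriented_spanning_tree G r (tree_graph x)"
proof -
  let ?N = "verts G - {r}" and ?H = "tree_graph x"
  have x: "x \<in> points" and rooted: "rooted ?N (parent x)" using assms unfolding tree_def by auto
  have "in_arcs ?H v = {chosen x v}" if v: "v \<in> ?N" for v
  proof -
    have "e = chosen x v" if "e \<in> chosen x ` ?N" "head G e = v" for e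
    proof -
      from that(1) obtain u where u: "u \<in> ?N" "e = chosen x u" by blast
      then show ?thesis using chosen_arc(2)[OF x u(1)] that(2) by simp
    qed
    then show ?thesis using chosen_arc(2)[OF x v] v by (auto simp: in_arcs_def)
  qed
  then have non_root: "\<forall>v\<in>?N. in_degree ?H v = 1" by (simp add: in_degree_def)
  have "head G e \<noteq> r" if "e \<in> chosen x ` ?N" for e
  proof -
    from that obtain u where u: "u \<in> ?N" "e = chosen x u" by blast
    then show ?thesis using chosen_arc(2)[OF x u(1)] by simp
  qed
  then have "in_arcs ?H r = {}" by (auto simp: in_arcs_def)
  then have root: "in_degree ?H r = 0" by (simp add: in_degree_def)
  have acyclic: "\<not> pre_digraph.cycle ?H p" for p
  proof
    assume "pre_digraph.cycle ?H p"
    then obtain u where p: "set p \<subseteq> arcs ?H" "pre_digraph.cas ?H u p u" "p \<noteq> []"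
      unfolding pre_digraph.cycle_def pre_digraph.awalk_def by blast
    let ?Z = "head G ` set p"
    have u: "u \<in> ?Z" using cas_last_head[OF p(2,3)] by simp
    have mem: "v \<in> ?N \<and> chosen x v \<in> set p" if "v \<in> ?Z" for v
    proof -
      from that obtain e where e: "e \<in> set p" "v = head G e" by blast
      then obtain v' where v': "v' \<in> ?N" "e = chosen x v'" using p(1) by auto
      then have "v' = v" using e(2) chosen_arc(2)[OF x v'(1)] by simp
      then show ?thesis using e v' by simp
    qed
    have "parent x v \<in> ?Z" if "v \<in> ?Z" for v
    proof -
      have v: "v \<in> ?N" "chosen x v \<in> set p" using mem[OF that] by auto
      show ?thesis
        using cas_tails[OF p(2) v(2)] u unfolding tree_graph_simps chosen_arc(3)[OF x v(1)] by metis
    qed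
    then have "parent x ` ?Z \<subseteq> ?Z" by blast
    moreover have "?Z \<subseteq> ?N"
    proof
      show "v \<in> ?N" if "v \<in> ?Z" for v using mem[OF that] ..
    qed
    moreover have "?Z \<noteq> {}" using p(3) by simp
    ultimately show False using rooted unfolding rooted_def by metis
  qed
  have "spanning ?H G" using represents_tree_graph[OF x] unfolding represents_def by blast
  then show ?thesis
    unfolding oriented_spanning_tree_def by (intro conjI non_root root) (simp_all add: acyclic)
qed

text \<open>The index list is reversed because walks follow the arcs from tail to head, while
  \<open>pt\<close> counts ancestors upwards.\<close>

lemma cas_ancestors:
  assumes x: "x \<in> points" and pt: "\<And>i. pt i \<in> verts G - {r}" "\<And>i. parent x (pt i) = pt (Suc i)"
  shows "pre_digraph.cas (tree_graph x) (pt m) (map (\<lambda>i. chosen x (pt i)) (rev [0..<m])) (pt 0)"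
proof (induction m)
  case (Suc m)
  then show ?case by (simp add: pre_digraph.cas.simps chosen_arc[OF x pt(1)] pt(2))
qed (simp add: pre_digraph.cas.simps)

lemma acyclic_imp_rooted:
  assumes x: "x \<in> points" and acyclic: "\<nexists>p. pre_digraph.cycle (tree_graph x) p"
  shows "rooted (verts G - {r}) (parent x)"
proof (rule ccontr)
  let ?N = "verts G - {r}" and ?H = "tree_graph x"
  assume "\<not> rooted ?N (parent x)"
  then obtain C where C: "orbit_cycle ?N (parent x) C"
    using not_rooted_imp_orbit_cycle[OF finite_N] by blast
  obtain w where w: "w \<in> C" using orbit_cycleD(2)[OF C] by blast
  define pt where "pt i = (parent x ^^ i) w" for i
  obtain n where n: "n > 0" "pt n = w" "inj_on pt {..<n}"
    using orbit_cycle_period[OF C w] unfolding pt_def by blast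
  have ptN: "pt i \<in> ?N" for i
    using orbit_cycle_closed[OF C w] orbit_cycleD(1)[OF C] unfolding pt_def by blast
  let ?p = "map (\<lambda>i. chosen x (pt i)) (rev [0..<n])"
  have step: "parent x (pt i) = pt (Suc i)" and pt0: "pt 0 = w" for i by (simp_all add: pt_def)
  have cas: "pre_digraph.cas ?H w ?p w"
    using cas_ancestors[where pt = pt and m = n, OF x ptN step] unfolding n(2) pt0 .
  have ne: "?p \<noteq> []" using n(1) by simp
  \<comment> \<open>A cycle may repeat only its base point. The vertices after the first are the
    heads of the arcs, and these are distinct by minimality of the period.\<close>
  have "tl (pre_digraph.awalk_verts ?H w ?p) = map (head G) ?p"
    using pre_digraph.awalk_verts_conv'[OF cas] ne by simp
  also have "\<dots> = map pt (rev [0..<n])" using chosen_arc(2)[OF x ptN] by simp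
  finally have "distinct (tl (pre_digraph.awalk_verts ?H w ?p))"
    using n(3) by (simp add: distinct_map lessThan_atLeast0)
  moreover have "pre_digraph.awalk ?H w ?p w"
    unfolding pre_digraph.awalk_def using cas ptN ptN[of 0] by (auto simp: pt0)
  ultimately have "pre_digraph.cycle ?H ?p" unfolding pre_digraph.cycle_def using ne by blast
  then show False using acyclic by blast
qed

lemma oriented_spanning_tree_imp_tree:
  assumes T: "oriented_spanning_tree G r T"
  obtains x where "tree x" "T = tree_graph x"
proof -
  let ?N = "verts G - {r}"
  have sub: "arcs T \<subseteq> arcs G" "verts T = verts G" "tail T = tail G" "head T = head G"
    using T unfolding oriented_spanning_tree_def spanning_def subgraph_def compatible_def by auto
  have "\<exists>j. j \<in> {1..in_degree G v} \<and> in_arcs T v = {inc v j}" if v: "v \<in> ?N" for v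
  proof -
    have "card (in_arcs T v) = 1"
      using T v unfolding oriented_spanning_tree_def in_degree_def by blast
    then obtain e where e: "in_arcs T v = {e}" by (auto simp: card_1_singleton_iff)
    then have "e \<in> in_arcs T v" by simp
    then have "e \<in> in_arcs G v" using sub by (auto simp: in_arcs_def)
    then obtain j where "j \<in> {1..in_degree G v}" "inc v j = e"
      using inc_bij[OF v] unfolding bij_betw_def by (metis imageE)
    with e show ?thesis by blast
  qed
  then obtain j where j: "\<And>v. v \<in> ?N \<Longrightarrow> j v \<in> {1..in_degree G v} \<and> in_arcs T v = {inc v (j v)}"
    by metis
  \<comment> \<open>The restriction makes \<open>x\<close> extensional, as membership in the product
    \<open>points\<close> requires.\<close>
  define x where "x = restrict j ?N"
  have x: "x \<in> points" unfolding points_def x_def using j by auto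
  have T_in: "in_arcs T v = {chosen x v}" if "v \<in> ?N" for v
    using j[OF that] that by (simp add: chosen_def x_def)
  have "in_arcs T r = {}"
  proof -
    have "finite (in_arcs T r)" using sub(1) finite_subset[of "in_arcs T r" "arcs G"] by (auto simp: in_arcs_def)
    moreover have "card (in_arcs T r) = 0" using T unfolding oriented_spanning_tree_def in_degree_def by blast
    ultimately show ?thesis by simp
  qed
  have "arcs T = chosen x ` ?N"
  proof (rule set_eqI, rule iffI)
    fix e assume e: "e \<in> arcs T"
    then have "e \<in> in_arcs T (head G e)" using sub by (simp add: in_arcs_def)
    moreover have "head G e \<in> verts G" using e sub(1) by auto
    ultimately have "head G e \<in> ?N" "e \<in> in_arcs T (head G e)" using \<open>in_arcs T r = {}\<close> by auto
    then show "e \<in> chosen x ` ?N" using T_in by blast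
  next
    fix e assume "e \<in> chosen x ` ?N"
    then obtain v where "v \<in> ?N" "e = chosen x v" by blast
    then have "e \<in> in_arcs T v" using T_in by simp
    then show "e \<in> arcs T" by simp
  qed
  then have eq: "T = tree_graph x" using sub by (simp add: tree_graph_def)
  moreover have "tree x"
    unfolding tree_def using x acyclic_imp_rooted[OF x] T unfolding eq oriented_spanning_tree_def by blast
  ultimately show thesis by (rule that[rotated])
qed

text \<open>\<open>neighboring\<close> asks for a unique index where \<open>adjacent\<close> asks
  for one; a second index would force \<open>x\<close> and \<open>y\<close> to agree at the
  first.\<close>

lemma clock_move_tree_graph:
  assumes "tree x" "tree y" "adjacent x y"
  shows "clock_move G r inc (tree_graph x) (tree_graph y)"
proof -
  have xy: "x \<in> points" "y \<in> points" using assms unfolding tree_def by auto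
  have "neighboring G r x y"
    using assms(3) unfolding adjacent_def neighboring_def
  proof (elim bexE conjE, intro ex1I conjI)
    fix v w
    assume v: "v \<in> verts G - {r}" "x v = y v + 1 \<or> x v + 1 = y v"
      and w: "w \<in> verts G - {r} \<and> (x w = y w + 1 \<or> x w + 1 = y w) \<and> (\<forall>u\<in>verts G - {r} - {w}. x u = y u)"
    show "w = v"
    proof (rule ccontr)
      assume "w \<noteq> v"
      then have "x v = y v" using v w by blast
      then show False using v(2) by simp
    qed
  qed
  moreover have "x \<in> lattice_points G r" "y \<in> lattice_points G r"
    using xy unfolding points_def lattice_points_def by simp_all
  ultimately show ?thesis
    unfolding clock_move_def
    by (intro conjI bexI[of _ x] bexI[of _ y] represents_tree_graph
        oriented_spanning_tree_tree_graph assms xy)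
qed

lemma clock_moves_connect:
  assumes "oriented_spanning_tree G r T" "oriented_spanning_tree G r T'"
  shows "(clock_move G r inc)\<^sup>*\<^sup>* T T'"
proof -
  obtain x where x: "tree x" "T = tree_graph x"
    by (rule oriented_spanning_tree_imp_tree[OF assms(1)])
  obtain y where y: "tree y" "T' = tree_graph y"
    by (rule oriented_spanning_tree_imp_tree[OF assms(2)])
  have "(\<lambda>x y. tree x \<and> tree y \<and> adjacent x y)\<^sup>*\<^sup>* x y"
    using cycle_side x(1) y(1) by (rule trees_connected)
  then have "(clock_move G r inc)\<^sup>*\<^sup>* (tree_graph x) (tree_graph y)"
  proof induction
    case (step y z)
    then have "clock_move G r inc (tree_graph y) (tree_graph z)" by (intro clock_move_tree_graph) auto
    with step.IH show ?case by (rule rtranclp.rtrancl_into_rtrancl)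
  qed simp
  then show ?thesis using x y by simp
qed

end

theorem theorem3p7:
  fixes G :: "(complex, 'e) pre_digraph"
    and \<gamma> :: "'e \<Rightarrow> real \<Rightarrow> complex"
    and e\<^sub>0 :: 'e
    and r :: complex
    and inc :: "complex \<Rightarrow> nat \<Rightarrow> 'e"
    and T T' :: "(complex, 'e) pre_digraph"
  assumes "plane_balanced_transverse_graph G \<gamma>"
    and "outer_edge G \<gamma> e\<^sub>0"
    and "r = head G e\<^sub>0"
    and "incoming_labelling G \<gamma> r inc"
    and "oriented_spanning_tree G r T"
    and "oriented_spanning_tree G r T'"
  shows "(clock_move G r inc)\<^sup>*\<^sup>* T T'"
proof -
  interpret plane_balanced_transverse_graph G \<gamma> by fact
  obtain U where e0: "e\<^sub>0 \<in> arcs G" and U: "U \<in> components (- drawing G \<gamma>)" "\<not> bounded U"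
      "path_image (\<gamma> e\<^sub>0) \<subseteq> frontier U"
    using assms(2) unfolding outer_edge_def by blast
  have "r \<in> path_image (\<gamma> e\<^sub>0)" unfolding path_image_edge[OF e0] assms(3) by simp
  interpret clock_graph G \<gamma> r inc
  proof
    show "incoming_labelling G \<gamma> r inc" by fact
    show "r \<in> verts G" using e0 assms(3) by simp
    show "\<exists>U\<in>components (- drawing G \<gamma>). \<not> bounded U \<and> r \<in> frontier U"
      using U \<open>r \<in> path_image (\<gamma> e\<^sub>0)\<close> by blast
  qed
  show ?thesis by (rule clock_moves_connect) fact+
qed

end
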